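(* Assume that for every $g\in\mathcal G$ there exists $h_g\in\mathcal H$ such that $\operatorname{Cov}[h_g(X)-f_g(X),h(X)]=0$ for all $h\in\mathcal H$. Then $C_X^{\dagger}C_{XY}\colon\mathcal G\to\mathcal H$ is a bounded operator and, for all $y\in\mathcal Y$ and $h\in\mathcal H$, $$\langle h,\ \mu_{Y|X=\cdot}(y)\rangle_{L^2(\mathbb P_X)}=\Big\langle h,\ \big(\mu_Y+(C_X^{\dagger}C_{XY})^{*}(\varphi(\cdot)-\mu_X)\big)(y)\Big\rangle_{L^2(\mathbb P_X)}.$$ Suppose in addition that any one of the following four conditions holds: (i) the kernel $k$ is characteristic; (ii) $\mathcal H_{\mathcal C}$ is dense in $L^2_{\mathcal C}(\mathbb P_X)$; (iii) for every $g\in\mathcal G$ there exist $h_g\in\mathcal H$ and a constant $c_g\in\mathbb R$ such that $h_g=f_g-c_g$ $\mathbb P_X$-a.e. in $\mathcal X$; (iv) $[f_{\psi(y)}]\in\mathcal H_{\mathcal C}$ for each $y\in\mathcal Y$. Then, for $\mathbb P_X$-a.e. $x\in\mathcal X$, $$\mu_{Y|X=x}=\mu_Y+(C_X^{\dagger}C_{XY})^{*}(\varphi(x)-\mu_X).$$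
   Context: Setting. $(\Omega,\Sigma,\mathbb P)$ is a probability space, $\mathcal X$ a measurable space, $\mathcal Y$ a Borel space (Borel isomorphic to a Borel subset of $[0,1]$). $k\colon\mathcal X\times\mathcal X\to\mathbb R$ and $\ell\colon\mathcal Y\times\mathcal Y\to\mathbb R$ are symmetric positive definite kernels such that $k(x,\cdot)$ and $\ell(y,\cdot)$ are Borel measurable for all $x,y$. $\mathcal H$ and $\mathcal G$ are the RKHSs of $k$ and $\ell$, assumed separable, with canonical feature maps $\varphi(x)=k(x,\cdot)\in\mathcal H$, $\psi(y)=\ell(y,\cdot)\in\mathcal G$. $X\colon\Omega\to\mathcal X$ and $Y\colon\Omega\to\mathcal Y$ are random variables with laws $\mathbb P_X,\mathbb P_Y$; $\mathbb P_{Y|X=x}$ is a fixed regular conditional distribution of $Y$ given $X=x$ (it exists and is $\mathbb P_X$-a.e. unique). Assume $\mathbb E[\|\varphi(X)\|_{\mathcal H}^2+\|\psi(Y)\|_{\mathcal G}^2]<\infty$. Then $\mathcal X_Y=\{x\in\mathcal X:\mathbb E[\|\psi(Y)\|_{\mathcal G}^2|X=x]<\infty\}$ has full $\mathbb P_X$-measure. Assume also that for $h\in\mathcal H$, $h=0$ $\mathbb P_X$-a.e. if and only if $h=0$; thus $\mathcal H$ is viewed as a subspace of $L^2(\mathbb P_X)$, and for $f\in L^2(\mathbb P_X)$ we write $f\in\mathcal H$ if $f$ agrees $\mathbb P_X$-a.e. with a (unique) element of $\mathcal H$. Means and covariances. Expectations of Hilbert-space-valued variables are Bochner integrals. For square-integrable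 $U,V$ with values in Hilbert spaces $\mathcal G,\mathcal H$, $\operatorname{Cov}[U,V]=\mathbb E[(U-\mathbb E U)\otimes(V-\mathbb E V)]\colon\mathcal H\to\mathcal G$, where $(g\otimes h)(h')=\langle h,h'\rangle g$; for real-valued variables this is the usual covariance; $\operatorname{Cov}[U]=\operatorname{Cov}[U,U]$. Set $\mu_X=\mathbb E[\varphi(X)]$, $\mu_Y=\mathbb E[\psi(Y)]$, $C_X=\operatorname{Cov}[\varphi(X)]$, $C_{XY}=\operatorname{Cov}[\varphi(X),\psi(Y)]\colon\mathcal G\to\mathcal H$. Conditional objects. $\mu_{Y|X=x}=\mathbb E[\psi(Y)|X=x]\in\mathcal G$ (integral of $\psi$ against $\mathbb P_{Y|X=x}$) for $x\in\mathcal X_Y$ and $\mu_{Y|X=x}=0$ otherwise. For $g\in\mathcal G$, $f_g(x)=\mathbb E[g(Y)|X=x]$ (integral of $g$ against $\mathbb P_{Y|X=x}$) for $x\in\mathcal X_Y$ and $f_g(x)=0$ otherwise; $f_g\in L^2(\mathbb P_X)$. Quotient space. $L^2_{\mathcal C}(\mathbb P_X)$ is the quotient of $L^2(\mathbb P_X)$ by the $\mathbb P_X$-a.e. constant functions, with inner product $\langle[f_1],[f_2]\rangle=\operatorname{Cov}[f_1(X),f_2(X)]$; $\mathcal H_{\mathcal C}=\{[h]:h\in\mathcal H\}\subseteq L^2_{\mathcal C}(\mathbb P_X)$. The kernel $k$ is characteristic if the map $\mathbb Q\mapsto\int\varphi\,d\mathbb Q\in\mathcal H$ is injective on the set of probability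 measures $\mathbb Q$ on $\mathcal X$ with $\int\|\varphi(x)\|_{\mathcal H}\,d\mathbb Q(x)<\infty$. $A^{*}$ is the adjoint and $A^{\dagger}$ the Moore–Penrose pseudo-inverse of a bounded operator $A$ between Hilbert spaces: the linear extension of $(A|_{(\ker A)^\perp})^{-1}\colon\operatorname{ran}A\to(\ker A)^\perp$ to $\operatorname{dom}A^\dagger=\operatorname{ran}A\oplus(\operatorname{ran}A)^\perp$ with $\ker A^\dagger=(\operatorname{ran}A)^\perp$ (possibly unbounded). *)

theory Defs
  imports "HOL-Probability.Probability"
begin

section \<open>Kernels and reproducing kernel Hilbert spaces\<close>

(* As usual for kernels, "positive definite" is meant in the non-strict sense. *)
definition sym_pd_kernel :: "'a set \<Rightarrow> ('a \<Rightarrow> 'a \<Rightarrow> real) \<Rightarrow> bool" where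
  "sym_pd_kernel S k \<longleftrightarrow>
     (\<forall>x\<in>S. \<forall>y\<in>S. k x y = k y x) \<and>
     (\<forall>(n::nat) x a. (\<forall>i<n. x i \<in> S) \<longrightarrow>
        0 \<le> (\<Sum>i<n. \<Sum>j<n. a i * a j * k (x i) (x j)))"

(* The Hilbert space of functions on S is carried by a type 'h together with evl, where
   evl h is the function represented by h: evl is linear and injective, so 'h is identified with
   the function space {evl h |h} restricted to S. The last clause says that every k(x,_) belongs
   to the space and has the reproducing property. Completeness and separability are
   provided by the type class constraints. *)
definition is_RKHS ::
  "'a set \<Rightarrow> ('a \<Rightarrow> 'a \<Rightarrow> real) \<Rightarrow>
   ('h::{real_inner, banach, second_countable_topology} \<Rightarrow> 'a \<Rightarrow> real) \<Rightarrow> bool" where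
  "is_RKHS S k evl \<longleftrightarrow>
     (\<forall>h h'. \<forall>x\<in>S. evl (h + h') x = evl h x + evl h' x) \<and>
     (\<forall>c h. \<forall>x\<in>S. evl (c *\<^sub>R h) x = c * evl h x) \<and>
     (\<forall>h h'. (\<forall>x\<in>S. evl h x = evl h' x) \<longrightarrow> h = h') \<and>
     (\<forall>x\<in>S. \<exists>p. (\<forall>x'\<in>S. evl p x' = k x x') \<and> (\<forall>h. evl h x = h \<bullet> p))"

definition feature_map ::
  "'a set \<Rightarrow> ('a \<Rightarrow> 'a \<Rightarrow> real) \<Rightarrow> ('h \<Rightarrow> 'a \<Rightarrow> real) \<Rightarrow> 'a \<Rightarrow> 'h" where
  "feature_map S k evl x = (THE p. \<forall>x'\<in>S. evl p x' = k x x')"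

(* Here phi is the canonical feature map of the kernel. *)
definition characteristic ::
  "'a measure \<Rightarrow> ('a \<Rightarrow> 'h::{real_inner, banach, second_countable_topology}) \<Rightarrow> bool" where
  "characteristic N phi \<longleftrightarrow>
     inj_on (\<lambda>Q. LINT x|Q. phi x)
       {Q. sets Q = sets N \<and> prob_space Q \<and> integrable Q (\<lambda>x. norm (phi x))}"

section \<open>Borel spaces and regular conditional distributions\<close>

definition Borel_isomorphic_to_unit_interval_subset :: "'a measure \<Rightarrow> bool" where
  "Borel_isomorphic_to_unit_interval_subset N \<longleftrightarrow>
     (\<exists>B\<in>sets (borel :: real measure). B \<subseteq> {0..1} \<and>
        (\<exists>f. bij_betw f (space N) B \<and>
             f \<in> N \<rightarrow>\<^sub>M restrict_space borel B \<and>
             the_inv_into (space N) f \<in> restrict_space borel B \<rightarrow>\<^sub>M N))"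

definition regular_cond_distr ::
  "'w measure \<Rightarrow> 'x measure \<Rightarrow> ('w \<Rightarrow> 'x) \<Rightarrow> 'y measure \<Rightarrow> ('w \<Rightarrow> 'y) \<Rightarrow>
   ('x \<Rightarrow> 'y measure) \<Rightarrow> bool" where
  "regular_cond_distr M MX X MY Y \<kappa> \<longleftrightarrow>
     \<kappa> \<in> MX \<rightarrow>\<^sub>M prob_algebra MY \<and>
     (\<forall>A\<in>sets MX. \<forall>B\<in>sets MY.
        emeasure M {\<omega>\<in>space M. X \<omega> \<in> A \<and> Y \<omega> \<in> B} =
        (\<integral>\<^sup>+x\<in>A. emeasure (\<kappa> x) B \<partial>distr M MX X))"

definition finite_cond_moment_set ::
  "'x measure \<Rightarrow> ('x \<Rightarrow> 'y measure) \<Rightarrow> ('y \<Rightarrow> 'g::real_normed_vector) \<Rightarrow> 'x set" where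
  "finite_cond_moment_set MX \<kappa> \<psi> =
     {x\<in>space MX. (\<integral>\<^sup>+y. ennreal ((norm (\<psi> y))\<^sup>2) \<partial>\<kappa> x) < \<infinity>}"

definition cond_mean ::
  "'x measure \<Rightarrow> ('x \<Rightarrow> 'y measure) \<Rightarrow> ('y \<Rightarrow> 'g::{banach, second_countable_topology}) \<Rightarrow>
   'x \<Rightarrow> 'g" where
  "cond_mean MX \<kappa> \<psi> x =
     (if x \<in> finite_cond_moment_set MX \<kappa> \<psi> then LINT y|\<kappa> x. \<psi> y else 0)"

definition cond_fun ::
  "'x measure \<Rightarrow> ('x \<Rightarrow> 'y measure) \<Rightarrow> ('y \<Rightarrow> 'g::real_normed_vector) \<Rightarrow>
   ('g \<Rightarrow> 'y \<Rightarrow> real) \<Rightarrow> 'g \<Rightarrow> 'x \<Rightarrow> real" where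
  "cond_fun MX \<kappa> \<psi> evl g x =
     (if x \<in> finite_cond_moment_set MX \<kappa> \<psi> then LINT y|\<kappa> x. evl g y else 0)"

section \<open>Covariances\<close>

definition cov :: "'w measure \<Rightarrow> ('w \<Rightarrow> real) \<Rightarrow> ('w \<Rightarrow> real) \<Rightarrow> real" where
  "cov M U V = (LINT \<omega>|M. (U \<omega> - (LINT \<omega>'|M. U \<omega>')) * (V \<omega> - (LINT \<omega>'|M. V \<omega>')))"

(* E[(U - EU) (x) (V - EV)] applied to h, using (g (x) h')(h) = <h',h> g. Evaluation at h is
   bounded and linear on Hilbert-Schmidt operators, so it commutes with the Bochner integral;
   the operator-valued expectation is therefore given by this vector-valued Bochner integral
   for each h. *)
definition cov_op ::
  "'w measure \<Rightarrow> ('w \<Rightarrow> 'g::{real_inner, banach, second_countable_topology}) \<Rightarrow>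
   ('w \<Rightarrow> 'h::{real_inner, banach, second_countable_topology}) \<Rightarrow> 'h \<Rightarrow> 'g" where
  "cov_op M U V h =
     (LINT \<omega>|M. ((V \<omega> - (LINT \<omega>'|M. V \<omega>')) \<bullet> h) *\<^sub>R (U \<omega> - (LINT \<omega>'|M. U \<omega>')))"

section \<open>Moore-Penrose pseudo-inverse\<close>

definition pinv_dom :: "('a::real_inner \<Rightarrow> 'b::real_inner) \<Rightarrow> 'b set" where
  "pinv_dom A = {u + v |u v. u \<in> range A \<and> v \<in> (range A)\<^sup>\<bottom>}"

(* Only meaningful on pinv_dom A: take the component of y in range A, then invert the
   restriction of A to the orthogonal complement of its kernel. *)
definition pinv :: "('a::real_inner \<Rightarrow> 'b::real_inner) \<Rightarrow> 'b \<Rightarrow> 'a" where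
  "pinv A y = the_inv_into ({x. A x = 0}\<^sup>\<bottom>) A (THE u. u \<in> range A \<and> y - u \<in> (range A)\<^sup>\<bottom>)"

section \<open>Square-integrable functions modulo constants\<close>

definition L2 :: "'x measure \<Rightarrow> ('x \<Rightarrow> real) set" where
  "L2 P = {f. f \<in> borel_measurable P \<and> integrable P (\<lambda>x. (f x)\<^sup>2)}"

definition L2_inner :: "'x measure \<Rightarrow> ('x \<Rightarrow> real) \<Rightarrow> ('x \<Rightarrow> real) \<Rightarrow> real" where
  "L2_inner P f g = (LINT x|P. f x * g x)"

definition eq_mod_const :: "'x measure \<Rightarrow> (('x \<Rightarrow> real) \<times> ('x \<Rightarrow> real)) set" where
  "eq_mod_const P = {(f, f'). f \<in> L2 P \<and> f' \<in> L2 P \<and> (\<exists>c. AE x in P. f x - f' x = c)}"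

definition L2C :: "'x measure \<Rightarrow> ('x \<Rightarrow> real) set set" where
  "L2C P = L2 P // eq_mod_const P"

definition L2C_class :: "'x measure \<Rightarrow> ('x \<Rightarrow> real) \<Rightarrow> ('x \<Rightarrow> real) set" where
  "L2C_class P f = eq_mod_const P `` {f}"

(* Difference and inner product are computed on representatives; neither depends on the choice.
   With P the law of X, cov P f1 f2 is Cov[f1(X), f2(X)]. *)
definition L2C_minus ::
  "'x measure \<Rightarrow> ('x \<Rightarrow> real) set \<Rightarrow> ('x \<Rightarrow> real) set \<Rightarrow> ('x \<Rightarrow> real) set" where
  "L2C_minus P F G = L2C_class P (\<lambda>x. (SOME f. f \<in> F) x - (SOME g. g \<in> G) x)"

definition L2C_inner :: "'x measure \<Rightarrow> ('x \<Rightarrow> real) set \<Rightarrow> ('x \<Rightarrow> real) set \<Rightarrow> real" where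
  "L2C_inner P F G = cov P (SOME f. f \<in> F) (SOME g. g \<in> G)"

definition L2C_norm :: "'x measure \<Rightarrow> ('x \<Rightarrow> real) set \<Rightarrow> real" where
  "L2C_norm P F = sqrt (L2C_inner P F F)"

definition dense_in_L2C :: "'x measure \<Rightarrow> ('x \<Rightarrow> real) set set \<Rightarrow> bool" where
  "dense_in_L2C P D \<longleftrightarrow>
     D \<subseteq> L2C P \<and> (\<forall>F\<in>L2C P. \<forall>e>0. \<exists>G\<in>D. L2C_norm P (L2C_minus P F G) < e)"

definition RKHS_mod_const :: "'x measure \<Rightarrow> ('h \<Rightarrow> 'x \<Rightarrow> real) \<Rightarrow> ('x \<Rightarrow> real) set set" where
  "RKHS_mod_const P evl = {L2C_class P (evl h) |h. True}"

end

theory Submission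
  imports Defs
begin

text \<open>
  Everything reduces to linear least squares in Hilbert space. Write \<open>P\<close> for the law of \<open>X\<close> and
  \<open>m x\<close> for the conditional mean embedding. Integrating against the regular conditional distribution
  shows that \<open>m\<close> is square integrable, that \<open>f\<^sub>g = \<langle>g, m(\<cdot>)\<rangle>\<close>, that \<open>m\<close> and \<open>\<psi>(Y)\<close> have the same
  mean, and that \<open>C\<^sub>X\<^sub>Y\<close> is the cross-covariance of \<open>\<phi>\<close> and \<open>m\<close> under \<open>P\<close>. What remains is
  a statement about two square-integrable random vectors \<open>\<phi>\<close> and \<open>m\<close> on the probability space of \<open>P\<close>.

  The hypothesis on \<open>h\<^sub>g\<close> says \<open>C\<^sub>X h\<^sub>g = C\<^sub>X\<^sub>Y g\<close>, so the range of \<open>C\<^sub>X\<^sub>Y\<close> lies in the range of \<open>C\<^sub>X\<close>. By a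
  Baire category argument (\<open>bounded_linear_pinv_comp\<close>, a form of the closed graph theorem)
  \<open>B = C\<^sub>X\<^sup>\<dagger> C\<^sub>X\<^sub>Y\<close> is bounded, so it has an adjoint by Riesz representation. Moreover \<open>C\<^sub>X B = C\<^sub>X\<^sub>Y\<close>,
  which means that each residual \<open>r\<^sub>g = f\<^sub>g - B g\<close> is uncorrelated with \<open>\<H>\<close>. Since
  \<open>\<langle>g, m(x) - \<mu>\<^sub>Y - B\<^sup>*(\<phi>(x) - \<mu>\<^sub>X)\<rangle> = r\<^sub>g(x) - \<E> r\<^sub>g\<close>, this is already the identity in
  \<open>L\<^sup>2(P)\<close> tested against \<open>\<H>\<close>.

  For the almost sure identity it is enough that \<open>r\<^sub>g\<close> is almost surely constant for all \<open>g = \<psi>(y)\<close>: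
  the \<open>g\<close> that are orthogonal to the prediction error almost surely form a closed subspace, the
  vectors \<open>\<psi>(y)\<close> span a dense subspace, and \<open>\<G>\<close> is separable. Each of the four conditions makes an
  \<open>r\<^sub>g\<close> that is uncorrelated with \<open>\<H>\<close> constant. If \<open>f\<^sub>g\<close> is an element of \<open>\<H>\<close> up to a constant, so is
  \<open>r\<^sub>g\<close>, which is then uncorrelated with itself. If \<open>\<H>\<^sub>\<C>\<close> is dense, then
  \<open>Var(r\<^sub>g - h) = Var r\<^sub>g + Var h \<ge> Var r\<^sub>g\<close> excludes approximation of \<open>r\<^sub>g\<close> unless \<open>Var r\<^sub>g = 0\<close>. If the
  kernel is characteristic, a centred nonzero \<open>r\<close> with \<open>\<integral> r \<phi> dP = 0\<close> would give two different
  probability measures, with densities proportional to \<open>\<bar>r\<bar>\<close> and \<open>\<bar>r\<bar> + r\<close>, of equal mean embedding.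
\<close>

section \<open>Orthogonal projection and Riesz representation\<close>

text \<open>A minimizing sequence for the distance from \<open>x\<close> to the subspace is Cauchy by the parallelogram identity,
  and its limit is the foot of the perpendicular.\<close>

lemma ex_orthogonal_projection:
  fixes S :: "'a::{real_inner, banach} set"
  assumes cl: "closed S" and S: "subspace S"
  shows "\<exists>u\<in>S. x - u \<in> S\<^sup>\<bottom>"
proof -
  define D where "D = (INF s\<in>S. (norm (x - s))\<^sup>2)"
  have S0: "0 \<in> S" using S by (rule subspace_0)
  have bdd: "bdd_below ((\<lambda>s. (norm (x - s))\<^sup>2) ` S)"
    by (rule bdd_belowI[of _ 0]) auto
  have D_le: "D \<le> (norm (x - s))\<^sup>2" if "s \<in> S" for s
    unfolding D_def using bdd that by (rule cINF_lower)
  have "\<exists>s\<in>S. (norm (x - s))\<^sup>2 < D + 1 / real (Suc n)" for n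
    unfolding D_def using S0 bdd
    by (subst cINF_less_iff[symmetric]) auto
  then obtain s where sS: "\<And>n. s n \<in> S"
    and s: "\<And>n. (norm (x - s n))\<^sup>2 < D + 1 / real (Suc n)"
    by metis
  have close: "(norm (s m - s n))\<^sup>2 \<le> 2 / real (Suc m) + 2 / real (Suc n)" for m n
  proof -
    have "(1/2) *\<^sub>R (s m + s n) \<in> S"
      using S sS by (intro subspace_scale subspace_add)
    then have "D \<le> (norm (x - (1/2) *\<^sub>R (s m + s n)))\<^sup>2" by (rule D_le)
    moreover have "(norm (s m - s n))\<^sup>2
        = 2 * (norm (x - s m))\<^sup>2 + 2 * (norm (x - s n))\<^sup>2 - 4 * (norm (x - (1/2) *\<^sub>R (s m + s n)))\<^sup>2"
      unfolding power2_norm_eq_inner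
      by (simp add: inner_diff inner_add inner_commute algebra_simps)
    ultimately show ?thesis using s[of m] s[of n] by simp
  qed
  have "Cauchy s"
  proof (rule metric_CauchyI)
    fix e :: real assume e: "0 < e"
    obtain N where N: "4 / e\<^sup>2 < real N" using reals_Archimedean2 by blast
    then have N0: "0 < real N" using e by (meson divide_pos_pos less_trans zero_less_numeral zero_less_power)
    have "dist (s m) (s n) < e" if "m \<ge> N" "n \<ge> N" for m n
    proof -
      have "2 / real (Suc m) < 2 / real N" "2 / real (Suc n) < 2 / real N"
        using that N0 by (auto intro!: divide_strict_left_mono)
      then have "(norm (s m - s n))\<^sup>2 < 4 / real N"
        using close[of m n] by simp
      also have "\<dots> < e\<^sup>2" using N N0 e by (simp add: field_simps)
      finally show ?thesis using e by (simp add: dist_norm power_less_imp_less_base)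
    qed
    then show "\<exists>M. \<forall>m\<ge>M. \<forall>n\<ge>M. dist (s m) (s n) < e" by blast
  qed
  then obtain u where lim: "s \<longlonglongrightarrow> u" using Cauchy_convergent_iff convergent_def by blast
  have uS: "u \<in> S" using cl sS lim by (rule closed_sequentially)
  have "(norm (x - u))\<^sup>2 \<le> D"
  proof (rule LIMSEQ_le)
    show "(\<lambda>n. (norm (x - s n))\<^sup>2) \<longlonglongrightarrow> (norm (x - u))\<^sup>2"
      by (intro tendsto_intros lim)
    show "(\<lambda>n. D + 1 / real (Suc n)) \<longlonglongrightarrow> D"
      using tendsto_add[OF tendsto_const LIMSEQ_inverse_real_of_nat, of D] by (simp add: inverse_eq_divide)
    show "\<exists>N. \<forall>n\<ge>N. (norm (x - s n))\<^sup>2 \<le> D + 1 / real (Suc n)"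
      using s less_imp_le by blast
  qed
  have "(x - u) \<bullet> v = 0" if v: "v \<in> S" for v
  proof (cases "v = 0")
    case False
    \<comment> \<open>The minimizer over the line through \<open>u\<close> in direction \<open>v\<close>; it can only beat \<open>u\<close> if \<open>x - u\<close> is not orthogonal to \<open>v\<close>.\<close>
    define t where "t = ((x - u) \<bullet> v) / (v \<bullet> v)"
    have "u + t *\<^sub>R v \<in> S" using S uS v by (intro subspace_scale subspace_add)
    then have "(norm (x - u))\<^sup>2 \<le> (norm (x - (u + t *\<^sub>R v)))\<^sup>2"
      using D_le \<open>(norm (x - u))\<^sup>2 \<le> D\<close> order_trans by blast
    also have "\<dots> = (norm (x - u))\<^sup>2 - 2 * t * ((x - u) \<bullet> v) + t\<^sup>2 * (v \<bullet> v)"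
      unfolding power2_norm_eq_inner
      by (simp add: inner_diff inner_add inner_commute algebra_simps power2_eq_square)
    also have "\<dots> = (norm (x - u))\<^sup>2 - ((x - u) \<bullet> v)\<^sup>2 / (v \<bullet> v)"
      using False by (simp add: t_def field_simps power2_eq_square)
    finally have "((x - u) \<bullet> v)\<^sup>2 / (v \<bullet> v) \<le> 0" by simp
    then show ?thesis using False
      by (metis divide_le_0_iff inner_gt_zero_iff less_le_not_le power2_less_eq_zero_iff zero_less_power2)
  qed simp
  with uS show ?thesis
    by (intro bexI[of _ u]) (auto simp: orthogonal_comp_def orthogonal_def inner_commute)
qed

lemma orthogonal_comp_Int: "x \<in> S \<Longrightarrow> x \<in> S\<^sup>\<bottom> \<Longrightarrow> x = 0"
  by (auto simp: orthogonal_comp_def orthogonal_self)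

lemma closed_orthogonal_comp: "closed (S\<^sup>\<bottom>)"
proof -
  have "S\<^sup>\<bottom> = (\<Inter>y\<in>S. {x. y \<bullet> x = 0})" by (auto simp: orthogonal_comp_def orthogonal_def)
  moreover have "closed {x. y \<bullet> x = 0}" for y :: 'a
    by (intro closed_Collect_eq continuous_intros)
  ultimately show ?thesis by (auto intro: closed_INT)
qed

lemma subspace_closure:
  fixes S :: "'a::real_normed_vector set"
  assumes S: "subspace S"
  shows "subspace (closure S)"
proof (rule subspaceI)
  show "0 \<in> closure S" using subspace_0[OF S] closure_subset by blast
  show "x + y \<in> closure S" if xy: "x \<in> closure S" "y \<in> closure S" for x y
  proof -
    obtain f g where "\<forall>n. f n \<in> S" "f \<longlonglongrightarrow> x" "\<forall>n. g n \<in> S" "g \<longlonglongrightarrow> y"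
      using xy unfolding closure_sequential by blast
    then have "\<forall>n. f n + g n \<in> S" "(\<lambda>n. f n + g n) \<longlonglongrightarrow> x + y"
      by (auto intro: subspace_add[OF S] tendsto_add)
    then show ?thesis unfolding closure_sequential by (intro exI[of _ "\<lambda>n. f n + g n"]) simp
  qed
  show "c *\<^sub>R x \<in> closure S" if xy: "x \<in> closure S" for c x
  proof -
    obtain f where "\<forall>n. f n \<in> S" "f \<longlonglongrightarrow> x"
      using xy unfolding closure_sequential by blast
    then have "\<forall>n. c *\<^sub>R f n \<in> S" "(\<lambda>n. c *\<^sub>R f n) \<longlonglongrightarrow> c *\<^sub>R x"
      by (auto intro: subspace_scale[OF S] tendsto_scaleR)
    then show ?thesis unfolding closure_sequential by (intro exI[of _ "\<lambda>n. c *\<^sub>R f n"]) simp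
  qed
qed

lemma closed_subspace_eq_UNIV:
  fixes S :: "'a::{real_inner, banach} set"
  assumes "closed S" "subspace S" and "\<And>x. (\<forall>y\<in>S. x \<bullet> y = 0) \<Longrightarrow> x = 0"
  shows "S = UNIV"
proof -
  have "x \<in> S" for x
  proof -
    obtain u where u: "u \<in> S" "x - u \<in> S\<^sup>\<bottom>" using ex_orthogonal_projection[OF assms(1,2)] by blast
    then have "x - u = 0"
      by (intro assms(3)) (auto simp: orthogonal_comp_def orthogonal_def inner_commute)
    with u show ?thesis by simp
  qed
  then show ?thesis by blast
qed

lemma bounded_linear_kernel:
  assumes "bounded_linear f"
  shows "closed {x. f x = 0}" and "subspace {x. f x = 0}"
proof -
  interpret bounded_linear f by fact
  show "closed {x. f x = 0}"
    by (intro closed_Collect_eq continuous_intros continuous_on continuous_on_id)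
  show "subspace {x. f x = 0}"
    by (auto simp: subspace_def add scaleR zero)
qed

text \<open>For a nonzero functional the orthogonal complement of the kernel is a line, and it contains the
  representing vector.\<close>

lemma Riesz_representation:
  fixes f :: "'a::{real_inner, banach} \<Rightarrow> real"
  assumes f: "bounded_linear f"
  shows "\<exists>r. \<forall>x. f x = x \<bullet> r"
proof (cases "\<forall>x. f x = 0")
  case False
  then obtain x0 where x0: "f x0 \<noteq> 0" by blast
  interpret bounded_linear f by fact
  obtain u where u: "f u = 0" "x0 - u \<in> {x. f x = 0}\<^sup>\<bottom>"
    using ex_orthogonal_projection[OF bounded_linear_kernel[OF f], of x0] by blast
  define z where "z = x0 - u"
  have z: "f z \<noteq> 0" using x0 u by (simp add: z_def diff)
  then have z0: "z \<noteq> 0" using zero by auto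
  have "f x = x \<bullet> ((f z / (z \<bullet> z)) *\<^sub>R z)" for x
  proof -
    have "f (x - (f x / f z) *\<^sub>R z) = 0" using z by (simp add: diff scaleR)
    then have "(x - (f x / f z) *\<^sub>R z) \<bullet> z = 0"
      using u by (auto simp: orthogonal_comp_def orthogonal_def z_def)
    then show ?thesis using z z0 by (simp add: inner_diff field_simps)
  qed
  then show ?thesis by blast
qed (auto intro: exI[of _ 0])

text \<open>Representing the functionals \<open>\<langle>f (\<cdot>), y\<rangle>\<close> shows that the adjoint, defined by choice, exists for every
  bounded operator on a complete space.\<close>

lemma inner_adjoint:
  fixes f :: "'a::{real_inner, banach} \<Rightarrow> 'b::real_inner"
  assumes f: "bounded_linear f"
  shows "f x \<bullet> y = x \<bullet> adjoint f y"
proof -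
  have "\<exists>r. \<forall>x. f x \<bullet> y = x \<bullet> r" for y
    by (intro Riesz_representation bounded_linear_inner_left_comp f)
  then obtain f' where "\<And>x y. f x \<bullet> y = x \<bullet> f' y" by metis
  then show ?thesis by (metis adjoint_unique)
qed

section \<open>Bounded compositions with a pseudo-inverse\<close>

text \<open>On the range of the operator, the pseudo-inverse picks the preimage that is orthogonal to the kernel.
  Completeness enters through the splitting of an arbitrary preimage along the closed kernel.\<close>

lemma pinv_range:
  fixes A :: "'a::{real_inner, banach} \<Rightarrow> 'b::real_inner"
  assumes A: "bounded_linear A" and y: "y \<in> range A"
  shows "A (pinv A y) = y" and "pinv A y \<in> {x. A x = 0}\<^sup>\<bottom>"
proof -
  interpret A: bounded_linear A by fact
  let ?K = "{x. A x = 0}"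
  have sub: "subspace (range A)"
    using A.linear by (simp add: linear_subspace_image)
  have "(THE u. u \<in> range A \<and> y - u \<in> (range A)\<^sup>\<bottom>) = y"
  proof (rule the_equality)
    show "y \<in> range A \<and> y - y \<in> (range A)\<^sup>\<bottom>"
      using y by (simp add: subspace_0 subspace_orthogonal_comp)
    fix u assume u: "u \<in> range A \<and> y - u \<in> (range A)\<^sup>\<bottom>"
    then have "y - u \<in> range A" using sub y by (simp add: subspace_diff)
    with u have "y - u = 0" by (blast intro: orthogonal_comp_Int)
    then show "u = y" by simp
  qed
  then have eq: "pinv A y = the_inv_into (?K\<^sup>\<bottom>) A y" by (simp add: pinv_def)
  have inj: "inj_on A (?K\<^sup>\<bottom>)"
  proof (rule inj_onI)
    fix a b assume a: "a \<in> ?K\<^sup>\<bottom>" and b: "b \<in> ?K\<^sup>\<bottom>" and "A a = A b"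
    then have "a - b \<in> ?K" by (simp add: A.diff)
    moreover have "a - b \<in> ?K\<^sup>\<bottom>" using a b by (simp add: subspace_diff subspace_orthogonal_comp)
    ultimately have "a - b = 0" by (rule orthogonal_comp_Int)
    then show "a = b" by simp
  qed
  obtain x where x: "y = A x" using y by blast
  obtain u where u: "A u = 0" "x - u \<in> ?K\<^sup>\<bottom>"
    using ex_orthogonal_projection[OF bounded_linear_kernel[OF A], of x] by blast
  then have "y = A (x - u)" by (simp add: x A.diff)
  with u have im: "y \<in> A ` (?K\<^sup>\<bottom>)" by blast
  show "A (pinv A y) = y" unfolding eq using inj im by (rule f_the_inv_into_f)
  show "pinv A y \<in> ?K\<^sup>\<bottom>" unfolding eq using inj im subset_refl by (rule the_inv_into_into)
qed

text \<open>The sets of \<open>g\<close> for which the domination holds with a fixed constant are closed and exhaust the space.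
  By the Baire category theorem one of them contains a ball, and linearity turns the constant on that ball
  into one proportional to the norm.\<close>

lemma pointwise_dominated_imp_uniformly_dominated:
  fixes T :: "'g::{real_inner, banach} \<Rightarrow> 'b::real_inner" and q :: "'b \<Rightarrow> real"
  assumes T: "bounded_linear T"
    and ptw: "\<And>g. \<exists>c. \<forall>u. \<bar>T g \<bullet> u\<bar> \<le> c * q u" and q: "\<And>u. 0 \<le> q u"
  shows "\<exists>N\<ge>0. \<forall>g u. \<bar>T g \<bullet> u\<bar> \<le> N * norm g * q u"
proof -
  interpret T: bounded_linear T by fact
  define E where "E n = {g. \<forall>u. \<bar>T g \<bullet> u\<bar> \<le> real n * q u}" for n :: nat
  have cl: "closed (E n)" for n
  proof -
    have "E n = (\<Inter>u. {g. \<bar>T g \<bullet> u\<bar> \<le> real n * q u})" by (auto simp: E_def)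
    moreover have "closed {g. \<bar>T g \<bullet> u\<bar> \<le> real n * q u}" for u
      by (intro closed_Collect_le continuous_intros T.continuous_on)
    ultimately show ?thesis by (auto intro: closed_INT)
  qed
  have Un: "(\<Union>n. E n) = UNIV"
  proof -
    have "\<exists>n. g \<in> E n" for g
    proof -
      obtain c where c: "\<And>u. \<bar>T g \<bullet> u\<bar> \<le> c * q u" using ptw by blast
      obtain n where "c \<le> real n" using real_arch_simple by blast
      then have "\<bar>T g \<bullet> u\<bar> \<le> real n * q u" for u
        using c[of u] q[of u] by (meson mult_right_mono order_trans)
      then show ?thesis by (auto simp: E_def)
    qed
    then show ?thesis by blast
  qed
  have "\<exists>n. interior (E n) \<noteq> {}"
  proof (rule ccontr)
    assume "\<nexists>n. interior (E n) \<noteq> {}"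
    then have "euclidean interior_of \<Union> (range E) = {}"
      using cl by (intro Baire_category_alt)
        (auto simp: completely_metrizable_space_euclidean)
    then show False using Un by simp
  qed
  then obtain n g0 r where r: "0 < r" "ball g0 r \<subseteq> E n"
    by (metis all_not_in_conv interior_subset open_contains_ball open_interior order_trans)
  have "\<bar>T g \<bullet> u\<bar> \<le> (4 * real n / r) * norm g * q u" for g u
  proof (cases "g = 0")
    case False
    \<comment> \<open>Scaled by \<open>t\<close>, the vector \<open>g\<close> is a difference of two points of the ball.\<close>
    define t where "t = r / (2 * norm g)"
    have t: "0 < t" using False r by (simp add: t_def)
    have "g0 \<in> E n" "g0 + t *\<^sub>R g \<in> E n"
      using r False by (auto intro!: subsetD[OF r(2)] simp: dist_norm t_def)
    then have "\<bar>T g0 \<bullet> u\<bar> \<le> real n * q u" "\<bar>T g0 \<bullet> u + t * (T g \<bullet> u)\<bar> \<le> real n * q u"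
      by (auto simp: E_def T.add T.scaleR inner_add)
    then have "\<bar>t * (T g \<bullet> u)\<bar> \<le> 2 * (real n * q u)" by arith
    then have "t * \<bar>T g \<bullet> u\<bar> \<le> 2 * real n * q u"
      using t by (simp add: abs_mult)
    then have "\<bar>T g \<bullet> u\<bar> \<le> 2 * real n * q u / t" using t by (simp add: field_simps)
    also have "\<dots> = (4 * real n / r) * norm g * q u" using False r by (simp add: t_def)
    finally show ?thesis .
  qed (simp add: T.zero)
  moreover have "0 \<le> 4 * real n / r" using r by simp
  ultimately show ?thesis by blast
qed

text \<open>For \<open>B = A\<^sup>\<dagger> T\<close> one has \<open>\<langle>T g, u\<rangle> = \<langle>B g, A\<^sup>* u\<rangle>\<close>, so each \<open>\<bar>\<langle>T g, u\<rangle>\<bar>\<close> is at most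
  \<open>\<parallel>B g\<parallel> \<parallel>A\<^sup>* u\<parallel>\<close>, and the previous lemma makes the constant proportional to \<open>\<parallel>g\<parallel>\<close>. As \<open>B g\<close> is
  orthogonal to the kernel of \<open>A\<close>, it lies in the closure of the range of \<open>A\<^sup>*\<close>, where it can be tested
  against itself.\<close>

lemma bounded_linear_pinv_comp:
  fixes A :: "'a::{real_inner, banach} \<Rightarrow> 'b::{real_inner, banach}"
    and T :: "'g::{real_inner, banach} \<Rightarrow> 'b"
  assumes A: "bounded_linear A" and T: "bounded_linear T" and range: "range T \<subseteq> range A"
  shows "bounded_linear (\<lambda>g. pinv A (T g))"
proof -
  interpret A: bounded_linear A by fact
  interpret T: bounded_linear T by fact
  let ?K = "{x. A x = 0}"
  define B where "B = (\<lambda>g. pinv A (T g))"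
  have AB: "A (B g) = T g" and BK: "B g \<in> ?K\<^sup>\<bottom>" for g
    unfolding B_def using range by (auto intro!: pinv_range[OF A])
  have uniq: "b = B g" if "A b = T g" "b \<in> ?K\<^sup>\<bottom>" for b g
  proof -
    have "b - B g \<in> ?K" using that AB by (simp add: A.diff)
    moreover have "b - B g \<in> ?K\<^sup>\<bottom>"
      using that BK by (simp add: subspace_diff subspace_orthogonal_comp)
    ultimately have "b - B g = 0" by (rule orthogonal_comp_Int)
    then show ?thesis by simp
  qed
  have adj: "A x \<bullet> u = x \<bullet> adjoint A u" for x u by (rule inner_adjoint[OF A])
  have "\<exists>c. \<forall>u. \<bar>T g \<bullet> u\<bar> \<le> c * norm (adjoint A u)" for g
    by (intro exI[of _ "norm (B g)"]) (metis AB adj Cauchy_Schwarz_ineq2)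
  then obtain N where N: "N \<ge> 0" "\<And>g u. \<bar>T g \<bullet> u\<bar> \<le> N * norm g * norm (adjoint A u)"
    using pointwise_dominated_imp_uniformly_dominated[OF T, of "\<lambda>u. norm (adjoint A u)"] by auto
  have lin_adj: "linear (adjoint A)"
    by (rule linearI; rule vector_eq_ldot[THEN iffD1])
       (simp_all add: adj[symmetric] inner_add inner_commute[of "A _"])
  let ?S = "closure (range (adjoint A))"
  have subS: "subspace ?S" "closed ?S"
    by (auto intro!: subspace_closure linear_subspace_image lin_adj)
  have BS: "B g \<in> ?S" for g
  proof -
    obtain u where u: "u \<in> ?S" "B g - u \<in> ?S\<^sup>\<bottom>"
      using ex_orthogonal_projection[OF subS(2,1)] by blast
    have "A (B g - u) \<bullet> w = 0" for w
      unfolding adj using u(2) closure_subset[of "range (adjoint A)"]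
      by (auto simp: orthogonal_comp_def orthogonal_def inner_commute)
    then have "B g - u \<in> ?K" by (metis (mono_tags) inner_eq_zero_iff mem_Collect_eq)
    moreover have "?S \<subseteq> ?K\<^sup>\<bottom>"
      by (rule closure_minimal[OF _ closed_orthogonal_comp])
         (auto simp: orthogonal_comp_def orthogonal_def adj[symmetric])
    with u(1) BK have "B g - u \<in> ?K\<^sup>\<bottom>"
      by (intro subspace_diff subspace_orthogonal_comp) auto
    ultimately have "B g - u = 0" by (rule orthogonal_comp_Int)
    with u show ?thesis by simp
  qed
  have bound: "norm (B g) \<le> norm g * N" for g
  proof -
    have "?S \<subseteq> {v. \<bar>B g \<bullet> v\<bar> \<le> N * norm g * norm v}"
      by (rule closure_minimal)
         (auto simp: adj[symmetric] AB N intro!: closed_Collect_le continuous_intros)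
    with BS have "\<bar>B g \<bullet> B g\<bar> \<le> N * norm g * norm (B g)" by blast
    then have "norm (B g) * norm (B g) \<le> N * norm g * norm (B g)"
      by (simp add: power2_norm_eq_inner[symmetric] power2_eq_square)
    then show ?thesis
      by (cases "norm (B g) = 0") (use N in \<open>auto simp: mult.commute\<close>)
  qed
  moreover have "B (g + g') = B g + B g'" for g g'
    by (rule uniq[symmetric]) (simp_all add: A.add AB T.add BK subspace_add subspace_orthogonal_comp)
  moreover have "B (c *\<^sub>R g) = c *\<^sub>R B g" for c g
    by (rule uniq[symmetric]) (simp_all add: A.scaleR AB T.scaleR BK subspace_scale subspace_orthogonal_comp)
  ultimately have "bounded_linear B" by (intro bounded_linear_intro)
  then show ?thesis by (simp add: B_def)
qed

section \<open>Measurability in reproducing kernel Hilbert spaces\<close>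

lemma feature_map_reproducing:
  assumes R: "is_RKHS S k evl" and x: "x \<in> S"
  shows "evl h x = h \<bullet> feature_map S k evl x"
    and "x' \<in> S \<Longrightarrow> evl (feature_map S k evl x) x' = k x x'"
proof -
  have "\<forall>x\<in>S. \<exists>p. (\<forall>x'\<in>S. evl p x' = k x x') \<and> (\<forall>h. evl h x = h \<bullet> p)"
    using R unfolding is_RKHS_def by (elim conjE)
  with x obtain p where p: "\<forall>x'\<in>S. evl p x' = k x x'" "\<forall>h. evl h x = h \<bullet> p"
    by blast
  have inj: "\<forall>h h'. (\<forall>x\<in>S. evl h x = evl h' x) \<longrightarrow> h = h'"
    using R unfolding is_RKHS_def by (elim conjE)
  have eq: "feature_map S k evl x = p" unfolding feature_map_def
  proof (rule the_equality)
    show "\<forall>x'\<in>S. evl p x' = k x x'" by fact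
    fix q assume "\<forall>x'\<in>S. evl q x' = k x x'"
    with p(1) have "\<forall>x'\<in>S. evl q x' = evl p x'" by simp
    with inj show "q = p" by blast
  qed
  show "evl h x = h \<bullet> feature_map S k evl x" unfolding eq using p(2) by blast
  show "x' \<in> S \<Longrightarrow> evl (feature_map S k evl x) x' = k x x'" unfolding eq using p(1) by blast
qed

text \<open>The feature vectors span a dense subspace, since a vector orthogonal to all of them is the zero
  function. Stated as an induction principle: what holds on a closed subspace and for all feature vectors
  holds everywhere.\<close>

lemma feature_map_total:
  fixes evl :: "'h::{real_inner, banach, second_countable_topology} \<Rightarrow> 'a \<Rightarrow> real"
  assumes R: "is_RKHS S k evl" and V: "closed V" "subspace V"
    and feat: "\<And>x. x \<in> S \<Longrightarrow> feature_map S k evl x \<in> V"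
  shows "V = UNIV"
proof (rule closed_subspace_eq_UNIV[OF V])
  fix h assume "\<forall>y\<in>V. h \<bullet> y = 0"
  then have "\<forall>x\<in>S. evl h x = evl 0 x"
    using feat feature_map_reproducing[OF R] by simp
  moreover have "\<forall>h h'. (\<forall>x\<in>S. evl h x = evl h' x) \<longrightarrow> h = h'"
    using R unfolding is_RKHS_def by (elim conjE)
  ultimately show "h = 0" by blast
qed

text \<open>Pointwise limits preserve measurability, and convergence in the space implies pointwise convergence;
  so the vectors that are measurable as functions form a closed subspace.\<close>

lemma RKHS_measurable:
  fixes evl :: "'h::{real_inner, banach, second_countable_topology} \<Rightarrow> 'a \<Rightarrow> real"
  assumes R: "is_RKHS (space N) k evl" and k: "\<forall>x\<in>space N. k x \<in> borel_measurable N"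
  shows "evl h \<in> borel_measurable N"
proof -
  let ?p = "feature_map (space N) k evl"
  define V where "V = {h. (\<lambda>x. h \<bullet> ?p x) \<in> borel_measurable N}"
  have eq: "evl h \<in> borel_measurable N \<longleftrightarrow> h \<in> V" for h
    unfolding V_def mem_Collect_eq
    by (rule measurable_cong) (simp add: feature_map_reproducing(1)[OF R])
  have "V = UNIV"
  proof (rule feature_map_total[OF R])
    show "subspace V"
      by (rule subspaceI) (auto simp: V_def inner_add_left)
    show "closed V"
      unfolding closed_sequential_limits
    proof (intro allI impI)
      fix u l assume ul: "(\<forall>n. u n \<in> V) \<and> u \<longlonglongrightarrow> l"
      have "(\<lambda>x. l \<bullet> ?p x) \<in> borel_measurable N"
      proof (rule borel_measurable_LIMSEQ_real)
        show "(\<lambda>n. u n \<bullet> ?p x) \<longlonglongrightarrow> l \<bullet> ?p x" for x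
          using ul by (intro tendsto_inner tendsto_const) simp
        show "(\<lambda>x. u n \<bullet> ?p x) \<in> borel_measurable N" for n
          using ul by (simp add: V_def)
      qed
      then show "l \<in> V" by (simp add: V_def)
    qed
    fix x assume x: "x \<in> space N"
    have "evl (?p x) \<in> borel_measurable N \<longleftrightarrow> k x \<in> borel_measurable N"
      using feature_map_reproducing(2)[OF R x] by (intro measurable_cong)
    then show "?p x \<in> V" using k x by (simp add: eq)
  qed
  then show ?thesis using eq by simp
qed


text \<open>Pettis measurability for separable Hilbert spaces: a closed ball is a countable intersection of half-space
  conditions, one for each element of a countable dense set, and an open set is a countable union of closed
  balls.\<close>

lemma weakly_measurable_imp_measurable:
  fixes u :: "'a \<Rightarrow> 'h::{real_inner, second_countable_topology}"
  assumes u: "\<And>h. (\<lambda>x. h \<bullet> u x) \<in> borel_measurable N"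
  shows "u \<in> borel_measurable N"
proof -
  obtain D :: "'h set" where D: "countable D" "\<And>X. open X \<Longrightarrow> X \<noteq> {} \<Longrightarrow> \<exists>d\<in>D. d \<in> X"
    using countable_dense_setE by blast
  have norm_le: "norm v \<le> r \<longleftrightarrow> (\<forall>d\<in>D. d \<bullet> v \<le> r * norm d)" if r: "0 \<le> r" for v :: 'h and r
  proof
    assume "norm v \<le> r"
    then have "norm d * norm v \<le> norm d * r" for d :: 'h by (simp add: mult_left_mono)
    then show "\<forall>d\<in>D. d \<bullet> v \<le> r * norm d"
      by (metis mult.commute norm_cauchy_schwarz order_trans)
  next
    assume *: "\<forall>d\<in>D. d \<bullet> v \<le> r * norm d"
    have "open {d. r * norm d < d \<bullet> v}" by (intro open_Collect_less continuous_intros)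
    with * D(2)[of "{d. r * norm d < d \<bullet> v}"] have "{d. r * norm d < d \<bullet> v} = {}"
      by (metis (mono_tags, lifting) linorder_not_less mem_Collect_eq)
    then have "v \<bullet> v \<le> r * norm v" using linorder_not_less by blast
    then have "norm v * norm v \<le> r * norm v"
      by (simp add: power2_norm_eq_inner[symmetric] power2_eq_square)
    then show "norm v \<le> r" using r by (cases "v = 0") auto
  qed
  have ball: "{x \<in> space N. norm (u x - c) \<le> r} \<in> sets N" if "0 \<le> r" for c r
  proof -
    have "{x \<in> space N. \<forall>d\<in>D. d \<bullet> u x - d \<bullet> c \<le> r * norm d} \<in> sets N"
      using D(1) u by measurable
    then show ?thesis using norm_le[OF that] by (simp add: inner_diff_right)
  qed
  show ?thesis
  proof (rule borel_measurableI)
    fix S :: "'h set" assume S: "open S"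
    define I where "I = {(d, n). d \<in> D \<and> cball d (1 / real (Suc n)) \<subseteq> S}"
    have "\<exists>(d, n)\<in>I. s \<in> cball d (1 / real (Suc n))" if s: "s \<in> S" for s
    proof -
      obtain e where e: "0 < e" "ball s e \<subseteq> S" using S s openE by blast
      obtain n where n: "1 / real (Suc n) < e / 2"
        using nat_approx_posE e by (metis half_gt_zero)
      obtain d where d: "d \<in> D" "d \<in> ball s (1 / real (Suc n))"
        using D(2)[of "ball s (1 / real (Suc n))"] by auto
      have "cball d (1 / real (Suc n)) \<subseteq> ball s e"
      proof
        fix w assume "w \<in> cball d (1 / real (Suc n))"
        then have "dist s w < e"
          using d n dist_triangle[of s w d] by simp
        then show "w \<in> ball s e" by simp
      qed
      with e d have "(d, n) \<in> I" by (auto simp: I_def)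
      with d show ?thesis by (intro bexI[of _ "(d, n)"]) (auto simp: dist_commute)
    qed
    then have S_eq: "S = (\<Union>i\<in>I. cball (fst i) (1 / real (Suc (snd i))))"
      unfolding I_def by fastforce
    have cball_norm_eq: "cball d r = {s. norm (s - d) \<le> r}" for d :: 'h and r
      by (auto simp: dist_norm norm_minus_commute)
    have "u -` S \<inter> space N = (\<Union>i\<in>I. {x\<in>space N. norm (u x - fst i) \<le> 1 / real (Suc (snd i))})"
      by (subst S_eq, unfold cball_norm_eq) blast
    moreover have "countable I"
      by (rule countable_subset[of _ "D \<times> UNIV"]) (auto simp: I_def D(1))
    ultimately show "u -` S \<inter> space N \<in> sets N"
      by (simp only:, intro sets.countable_UN'' ball) simp_all
  qed
qed

lemma feature_map_measurable:
  fixes evl :: "'h::{real_inner, banach, second_countable_topology} \<Rightarrow> 'a \<Rightarrow> real"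
  assumes R: "is_RKHS (space N) k evl" and k: "\<forall>x\<in>space N. k x \<in> borel_measurable N"
  shows "feature_map (space N) k evl \<in> borel_measurable N"
proof (rule weakly_measurable_imp_measurable)
  fix h
  have "(\<lambda>x. h \<bullet> feature_map (space N) k evl x) \<in> borel_measurable N \<longleftrightarrow> evl h \<in> borel_measurable N"
    by (rule measurable_cong) (simp add: feature_map_reproducing(1)[OF R])
  then show "(\<lambda>x. h \<bullet> feature_map (space N) k evl x) \<in> borel_measurable N"
    using RKHS_measurable[OF R k] by simp
qed


section \<open>Integration against a regular conditional distribution\<close>

text \<open>The joint law of \<open>(X, Y)\<close> and the law composed from that of \<open>X\<close> and the kernel agree on rectangles,
  hence are equal.\<close>

lemma regular_cond_distr_nn_integral:
  assumes X[measurable]: "X \<in> M \<rightarrow>\<^sub>M MX" and Y[measurable]: "Y \<in> M \<rightarrow>\<^sub>M MY" and M: "prob_space M"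
    and rcd: "regular_cond_distr M MX X MY Y \<kappa>"
    and F[measurable]: "F \<in> borel_measurable (MX \<Otimes>\<^sub>M MY)"
  shows "(\<integral>\<^sup>+\<omega>. F (X \<omega>, Y \<omega>) \<partial>M) = (\<integral>\<^sup>+x. \<integral>\<^sup>+y. F (x, y) \<partial>\<kappa> x \<partial>distr M MX X)"
proof -
  have \<kappa>[measurable]: "\<kappa> \<in> MX \<rightarrow>\<^sub>M subprob_algebra MY"
    using rcd by (auto simp: regular_cond_distr_def intro: measurable_prob_algebraD)
  interpret M: prob_space M by fact
  interpret PX: prob_space "distr M MX X" by (rule M.prob_space_distr) fact
  \<comment> \<open>The section measures, moved to the product space so that the joint law is a monadic bind.\<close>
  define K where "K x = distr (\<kappa> x) (MX \<Otimes>\<^sub>M MY) (Pair x)" for x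
  have sets_\<kappa>[measurable_cong]: "x \<in> space MX \<Longrightarrow> sets (\<kappa> x) = sets MY" for x
    using subprob_measurableD(2)[OF \<kappa>] by simp
  have K[measurable]: "K \<in> MX \<rightarrow>\<^sub>M subprob_algebra (MX \<Otimes>\<^sub>M MY)"
    unfolding K_def by (rule measurable_distr2[where M=MY]) measurable
  have ne: "space (distr M MX X) \<noteq> {}" by (rule PX.not_empty)
  have eq: "distr M (MX \<Otimes>\<^sub>M MY) (\<lambda>\<omega>. (X \<omega>, Y \<omega>)) = distr M MX X \<bind> K" (is "?J = ?B")
  proof (rule measure_eqI_generator_eq)
    let ?E = "{a \<times> b | a b. a \<in> sets MX \<and> b \<in> sets MY}"
    show "Int_stable ?E" by (rule Int_stable_pair_measure_generator)
    show "?E \<subseteq> Pow (space MX \<times> space MY)" by (rule pair_measure_closed)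
    show "sets ?J = sigma_sets (space MX \<times> space MY) ?E" by (simp add: sets_pair_measure)
    show "sets ?B = sigma_sets (space MX \<times> space MY) ?E"
      using sets_bind[of "distr M MX X" K "MX \<Otimes>\<^sub>M MY"] ne subprob_measurableD(2)[OF K]
      by (simp add: sets_pair_measure)
    show "range (\<lambda>_::nat. space MX \<times> space MY) \<subseteq> ?E" by auto
    show "(\<Union>i::nat. space MX \<times> space MY) = space MX \<times> space MY" by simp
    show "emeasure ?J (space MX \<times> space MY) \<noteq> \<infinity>"
      by (simp add: emeasure_distr M.emeasure_eq_measure)
    fix S assume "S \<in> ?E"
    then obtain a b where S: "S = a \<times> b" and [measurable]: "a \<in> sets MX" "b \<in> sets MY" by auto
    have "emeasure ?J S = emeasure M {\<omega>\<in>space M. X \<omega> \<in> a \<and> Y \<omega> \<in> b}"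
      by (subst emeasure_distr) (auto simp: S intro!: arg_cong[where f="emeasure M"])
    also have "\<dots> = (\<integral>\<^sup>+x\<in>a. emeasure (\<kappa> x) b \<partial>distr M MX X)"
      using rcd by (auto simp: regular_cond_distr_def)
    also have "\<dots> = (\<integral>\<^sup>+x. emeasure (K x) S \<partial>distr M MX X)"
    proof (rule nn_integral_cong)
      fix x assume "x \<in> space (distr M MX X)"
      then have x: "x \<in> space MX" by simp
      then show "emeasure (\<kappa> x) b * indicator a x = emeasure (K x) S"
        unfolding K_def S
        by (subst emeasure_distr)
           (auto simp: sets_\<kappa> sets_eq_imp_space_eq[OF sets_\<kappa>] measurable_cong_sets[OF sets_\<kappa> refl]
                 split: split_indicator intro!: arg_cong2[where f=emeasure] dest: sets.sets_into_space)
    qed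
    also have "\<dots> = emeasure ?B S"
      by (rule emeasure_bind[symmetric, where N="MX \<Otimes>\<^sub>M MY"]) (use ne in \<open>auto simp: S\<close>)
    finally show "emeasure ?J S = emeasure ?B S" .
  qed
  have "(\<integral>\<^sup>+\<omega>. F (X \<omega>, Y \<omega>) \<partial>M) = (\<integral>\<^sup>+z. F z \<partial>?J)"
    by (simp add: nn_integral_distr)
  also have "\<dots> = (\<integral>\<^sup>+x. \<integral>\<^sup>+z. F z \<partial>K x \<partial>distr M MX X)"
    unfolding eq by (rule nn_integral_bind[where B="MX \<Otimes>\<^sub>M MY"]) auto
  also have "\<dots> = (\<integral>\<^sup>+x. \<integral>\<^sup>+y. F (x, y) \<partial>\<kappa> x \<partial>distr M MX X)"
    unfolding K_def
    by (intro nn_integral_cong, subst nn_integral_distr)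
       (auto simp: measurable_cong_sets[OF sets_\<kappa> refl])
  finally show ?thesis .
qed

text \<open>Signed integrands are split into positive and negative parts, whose inner integrals are finite almost
  everywhere because the outer ones are.\<close>

lemma regular_cond_distr_integral:
  fixes F :: "'x \<times> 'y \<Rightarrow> real"
  assumes X[measurable]: "X \<in> M \<rightarrow>\<^sub>M MX" and Y[measurable]: "Y \<in> M \<rightarrow>\<^sub>M MY" and M: "prob_space M"
    and rcd: "regular_cond_distr M MX X MY Y \<kappa>"
    and F[measurable]: "F \<in> borel_measurable (MX \<Otimes>\<^sub>M MY)"
    and int: "integrable M (\<lambda>\<omega>. F (X \<omega>, Y \<omega>))"
  shows "(LINT \<omega>|M. F (X \<omega>, Y \<omega>)) = (LINT x|distr M MX X. LINT y|\<kappa> x. F (x, y))"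
proof -
  have \<kappa>[measurable]: "\<kappa> \<in> MX \<rightarrow>\<^sub>M subprob_algebra MY"
    using rcd by (auto simp: regular_cond_distr_def intro: measurable_prob_algebraD)
  have sets_\<kappa>: "x \<in> space MX \<Longrightarrow> sets (\<kappa> x) = sets MY" for x
    using subprob_measurableD(2)[OF \<kappa>] by simp
  let ?P = "distr M MX X"
  define p where "p G x = (\<integral>\<^sup>+y. ennreal (G (x, y)) \<partial>\<kappa> x)" for G :: "'x \<times> 'y \<Rightarrow> real" and x
  have p_meas[measurable]: "p G \<in> borel_measurable MX"
    if [measurable]: "G \<in> borel_measurable (MX \<Otimes>\<^sub>M MY)" for G
    unfolding p_def by (rule nn_integral_measurable_subprob_algebra2[where N=MY]) (simp_all add: \<kappa>)
  have p_int: "(\<integral>\<^sup>+\<omega>. ennreal (G (X \<omega>, Y \<omega>)) \<partial>M) = (\<integral>\<^sup>+x. p G x \<partial>?P)"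
    if [measurable]: "G \<in> borel_measurable (MX \<Otimes>\<^sub>M MY)" for G
    unfolding p_def by (rule regular_cond_distr_nn_integral[OF X Y M rcd]) measurable
  have fin: "(\<integral>\<^sup>+x. p G x \<partial>?P) < \<infinity>" "AE x in ?P. p G x < \<infinity>"
     "integrable ?P (\<lambda>x. enn2real (p G x))"
     "(LINT x|?P. enn2real (p G x)) = enn2real (\<integral>\<^sup>+\<omega>. ennreal (G (X \<omega>, Y \<omega>)) \<partial>M)"
    if G: "G \<in> borel_measurable (MX \<Otimes>\<^sub>M MY)" and iG: "integrable M (\<lambda>\<omega>. G (X \<omega>, Y \<omega>))" for G
  proof -
    show lt: "(\<integral>\<^sup>+x. p G x \<partial>?P) < \<infinity>"
      using iG by (simp add: p_int[OF G, symmetric] real_integrable_def less_top)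
    show ae: "AE x in ?P. p G x < \<infinity>"
      using nn_integral_noteq_infinite[of "p G" ?P] lt p_meas[OF G] by (auto simp: less_top)
    have "AE x in ?P. ennreal (enn2real (p G x)) = p G x"
      using ae by eventually_elim simp
    then have eq: "(\<integral>\<^sup>+x. ennreal (enn2real (p G x)) \<partial>?P) = (\<integral>\<^sup>+x. p G x \<partial>?P)"
      by (rule nn_integral_cong_AE)
    show "integrable ?P (\<lambda>x. enn2real (p G x))"
      using lt eq p_meas[OF G] by (intro integrableI_nonneg) auto
    show "(LINT x|?P. enn2real (p G x)) = enn2real (\<integral>\<^sup>+\<omega>. ennreal (G (X \<omega>, Y \<omega>)) \<partial>M)"
      using p_meas[OF G] by (subst integral_eq_nn_integral) (auto simp: eq p_int[OF G])
  qed
  define G where "G z = - F z" for z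
  have G[measurable]: "G \<in> borel_measurable (MX \<Otimes>\<^sub>M MY)" by (simp add: G_def[abs_def])
  have iG: "integrable M (\<lambda>\<omega>. G (X \<omega>, Y \<omega>))" using int by (simp add: G_def)
  have "AE x in ?P. (LINT y|\<kappa> x. F (x, y)) = enn2real (p F x) - enn2real (p G x)"
    using fin(2)[OF F int] fin(2)[OF G iG] AE_space
  proof eventually_elim
    case (elim x)
    then have [measurable_cong]: "sets (\<kappa> x) = sets MY" and x: "x \<in> space MX" by (simp_all add: sets_\<kappa>)
    have "integrable (\<kappa> x) (\<lambda>y. F (x, y))"
      using elim x by (auto simp: real_integrable_def p_def G_def)
    then show ?case by (simp add: real_lebesgue_integral_def p_def G_def)
  qed
  moreover have "(\<lambda>x. LINT y|\<kappa> x. F (x, y)) \<in> borel_measurable MX"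
  proof -
    have "(\<lambda>x. distr (\<kappa> x) (MX \<Otimes>\<^sub>M MY) (Pair x)) \<in> MX \<rightarrow>\<^sub>M subprob_algebra (MX \<Otimes>\<^sub>M MY)"
      by (rule measurable_distr2[where M=MY]) measurable
    from measurable_compose[OF this integral_measurable_subprob_algebra[OF F]]
    show ?thesis
      by (rule measurable_cong[THEN iffD1, rotated])
         (auto simp: integral_distr measurable_cong_sets[OF sets_\<kappa> refl])
  qed
  ultimately have "(LINT x|?P. LINT y|\<kappa> x. F (x, y)) = (LINT x|?P. enn2real (p F x) - enn2real (p G x))"
    using p_meas[OF F] p_meas[OF G]
    by (intro integral_cong_AE) auto
  also have "\<dots> = (LINT \<omega>|M. F (X \<omega>, Y \<omega>))"
    unfolding real_lebesgue_integral_def[OF int]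
      Bochner_Integration.integral_diff[OF fin(3)[OF F int] fin(3)[OF G iG]]
      fin(4)[OF F int] fin(4)[OF G iG]
    by (simp add: G_def)
  finally show ?thesis ..
qed

section \<open>Square-integrable variables and their covariances\<close>

lemma L2_bound:
  assumes f: "f \<in> borel_measurable P" and g: "integrable P g" and le: "\<And>x. x \<in> space P \<Longrightarrow> (f x)\<^sup>2 \<le> g x"
  shows "f \<in> L2 P"
proof -
  have "integrable P (\<lambda>x. (f x)\<^sup>2)"
    using f by (intro Bochner_Integration.integrable_bound[OF g])
      (auto intro!: AE_I2 order_trans[OF le])
  with f show ?thesis by (simp add: L2_def)
qed

lemma square_add_le: "(a + b)\<^sup>2 \<le> 2 * a\<^sup>2 + 2 * b\<^sup>2" for a b :: real
  using zero_le_power2[of "a - b"] by (simp add: power2_eq_square algebra_simps)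

lemma L2_cong: "(\<And>x. x \<in> space P \<Longrightarrow> f x = g x) \<Longrightarrow> f \<in> L2 P \<longleftrightarrow> g \<in> L2 P"
  unfolding L2_def mem_Collect_eq
  by (intro arg_cong2[where f="(\<and>)"] measurable_cong Bochner_Integration.integrable_cong) auto

lemma L2_add: "f \<in> L2 P \<Longrightarrow> g \<in> L2 P \<Longrightarrow> (\<lambda>x. f x + g x) \<in> L2 P"
  by (rule L2_bound[where g="\<lambda>x. 2 * (f x)\<^sup>2 + 2 * (g x)\<^sup>2"]) (auto simp: L2_def square_add_le)

lemma L2_cmult: "f \<in> L2 P \<Longrightarrow> (\<lambda>x. c * f x) \<in> L2 P"
  by (auto simp: L2_def power_mult_distrib)

lemma L2_diff: "f \<in> L2 P \<Longrightarrow> g \<in> L2 P \<Longrightarrow> (\<lambda>x. f x - g x) \<in> L2 P"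
  using L2_add[OF _ L2_cmult[of g P "-1"], of f] by simp

lemma L2_abs: "f \<in> L2 P \<Longrightarrow> (\<lambda>x. \<bar>f x\<bar>) \<in> L2 P"
  by (auto simp: L2_def)

lemma (in finite_measure) L2_const: "(\<lambda>_. c) \<in> L2 M"
  by (simp add: L2_def)

lemma (in finite_measure) L2_integrable: "f \<in> L2 M \<Longrightarrow> integrable M f"
  by (auto simp: L2_def intro: square_integrable_imp_integrable)

lemma L2_norm_integrable_scaleR:
  fixes f :: "'a \<Rightarrow> real" and u :: "'a \<Rightarrow> 'b::{banach, second_countable_topology}"
  assumes "f \<in> L2 P" and u: "u \<in> borel_measurable P" "(\<lambda>x. norm (u x)) \<in> L2 P"
  shows "integrable P (\<lambda>x. f x *\<^sub>R u x)"
proof (rule Bochner_Integration.integrable_bound)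
  show "integrable P (\<lambda>x. (f x)\<^sup>2 + (norm (u x))\<^sup>2)" using assms by (auto simp: L2_def)
  have "\<bar>a\<bar> * b \<le> a\<^sup>2 + b\<^sup>2" for a b :: real
    using zero_le_power2[of "\<bar>a\<bar> - b"] zero_le_power2[of "\<bar>a\<bar> + b"] by (simp add: power2_eq_square algebra_simps)
  then show "AE x in P. norm (f x *\<^sub>R u x) \<le> norm ((f x)\<^sup>2 + (norm (u x))\<^sup>2)" by simp
qed (use assms in \<open>auto simp: L2_def\<close>)

lemma L2_mult_integrable:
  assumes "f \<in> L2 P" "g \<in> L2 P"
  shows "integrable P (\<lambda>x. f x * g x)"
  using L2_norm_integrable_scaleR[of f P g] assms L2_abs[OF assms(2)] by (simp add: L2_def)

lemma cov_cong:
  assumes "\<And>x. x \<in> space P \<Longrightarrow> f x = f' x" "\<And>x. x \<in> space P \<Longrightarrow> g x = g' x"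
  shows "cov P f g = cov P f' g'"
  using assms unfolding cov_def by (simp cong: Bochner_Integration.integral_cong)

lemma cov_distr:
  assumes X: "X \<in> M \<rightarrow>\<^sub>M N" and "f \<in> borel_measurable N" "g \<in> borel_measurable N"
  shows "cov (distr M N X) f g = cov M (\<lambda>\<omega>. f (X \<omega>)) (\<lambda>\<omega>. g (X \<omega>))"
  unfolding cov_def using assms by (simp add: integral_distr)

lemma cov_commute: "cov P f g = cov P g f"
  by (simp add: cov_def mult.commute)

context prob_space
begin

lemma cov_eq:
  assumes f: "f \<in> L2 M" and g: "g \<in> L2 M"
  shows "cov M f g = expectation (\<lambda>x. f x * g x) - expectation f * expectation g"
proof -
  note [simp] = L2_integrable[OF f] L2_integrable[OF g] L2_mult_integrable[OF f g]
  have "cov M f g = expectation (\<lambda>x. f x * g x - expectation g * f x - expectation f * g x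
      + expectation f * expectation g)"
    unfolding cov_def by (intro Bochner_Integration.integral_cong) (auto simp: algebra_simps)
  also have "\<dots> = expectation (\<lambda>x. f x * g x) - expectation f * expectation g"
    by (simp add: prob_space)
  finally show ?thesis .
qed

lemma cov_diff_left:
  assumes "f \<in> L2 M" "f' \<in> L2 M" "g \<in> L2 M"
  shows "cov M (\<lambda>x. f x - f' x) g = cov M f g - cov M f' g"
  using assms by (simp add: cov_eq L2_diff L2_integrable L2_mult_integrable left_diff_distrib)

lemma cov_diff_right:
  assumes "f \<in> L2 M" "g' \<in> L2 M" "g \<in> L2 M"
  shows "cov M f (\<lambda>x. g x - g' x) = cov M f g - cov M f g'"
  using cov_diff_left[OF assms(3,2,1)] by (simp add: cov_commute)

lemma cov_self_nonneg: "0 \<le> cov M f f"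
  unfolding cov_def by (rule integral_nonneg_AE) simp

lemma cov_self_eq_0_imp_const:
  assumes f: "f \<in> L2 M" and 0: "cov M f f = 0"
  shows "AE x in M. f x = expectation f"
proof -
  have d: "(\<lambda>x. f x - expectation f) \<in> L2 M" using f L2_const by (rule L2_diff)
  have "AE x in M. (f x - expectation f) * (f x - expectation f) = 0"
    using 0 L2_mult_integrable[OF d d] unfolding cov_def
    by (subst integral_nonneg_eq_0_iff_AE[symmetric]) auto
  then show ?thesis by eventually_elim simp
qed

lemma AE_eq_const_imp_expectation:
  assumes f: "f \<in> borel_measurable M" and c: "AE x in M. f x = (c::real)"
  shows "AE x in M. f x = expectation f"
proof -
  have "expectation f = expectation (\<lambda>_. c)" using f c by (intro integral_cong_AE) auto
  with c show ?thesis by (simp add: prob_space)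
qed

text \<open>Covariances ignore additive constants, hence only depend on classes modulo constants.\<close>

lemma cov_cong_const_right:
  assumes f: "f \<in> L2 M" and g: "g \<in> L2 M" "g' \<in> L2 M" and c: "AE x in M. g x - g' x = c"
  shows "cov M f g = cov M f g'"
proof -
  have "AE x in M. g x - g' x = expectation (\<lambda>x. g x - g' x)"
    using g c by (intro AE_eq_const_imp_expectation) (auto simp: L2_def)
  then have "AE x in M. g x - expectation g = g' x - expectation g'"
    using g by (simp add: L2_integrable algebra_simps)
  then show ?thesis using f g unfolding cov_def
    by (intro integral_cong_AE) (auto simp: L2_def)
qed

lemma cov_self_cong_const:
  assumes f: "f \<in> L2 M" and g: "g \<in> L2 M" and c: "AE x in M. f x - g x = c"
  shows "cov M f f = cov M g g"
  using cov_cong_const_right[OF f f g c] cov_cong_const_right[OF g f g c] by (simp add: cov_commute)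

lemma inner_L2:
  fixes u :: "'a \<Rightarrow> 'b::{real_inner, second_countable_topology}"
  assumes u: "u \<in> borel_measurable M" "(\<lambda>x. norm (u x)) \<in> L2 M"
  shows "(\<lambda>x. h \<bullet> u x) \<in> L2 M"
proof (rule L2_bound)
  show "integrable M (\<lambda>x. (norm h)\<^sup>2 * (norm (u x))\<^sup>2)" using u by (simp add: L2_def)
  show "(h \<bullet> u x)\<^sup>2 \<le> (norm h)\<^sup>2 * (norm (u x))\<^sup>2" for x
    by (metis Cauchy_Schwarz_ineq power2_norm_eq_inner)
qed (use u in simp)

lemma norm_L2_integrable:
  fixes u :: "'a \<Rightarrow> 'b::{banach, second_countable_topology}"
  assumes u: "u \<in> borel_measurable M" "(\<lambda>x. norm (u x)) \<in> L2 M"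
  shows "integrable M u"
  using L2_integrable[OF u(2)] u(1) by (simp add: integrable_norm_iff)

lemma norm_L2_diff_const:
  fixes u :: "'a \<Rightarrow> 'b::{banach, second_countable_topology}"
  assumes u: "u \<in> borel_measurable M" "(\<lambda>x. norm (u x)) \<in> L2 M"
  shows "(\<lambda>x. norm (u x - c)) \<in> L2 M"
proof (rule L2_bound)
  show "integrable M (\<lambda>x. 2 * (norm (u x))\<^sup>2 + 2 * (norm c)\<^sup>2)" using u by (simp add: L2_def)
  show "(norm (u x - c))\<^sup>2 \<le> 2 * (norm (u x))\<^sup>2 + 2 * (norm c)\<^sup>2" for x
    by (rule order_trans[OF power_mono[OF norm_triangle_ineq4] square_add_le]) simp
qed (use u in simp)

text \<open>Covariance operators are handled only through their bilinear forms, which are ordinary covariances of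
  real random variables.\<close>

lemma inner_cov_op:
  fixes u :: "'a \<Rightarrow> 'b::{real_inner, banach, second_countable_topology}"
    and v :: "'a \<Rightarrow> 'c::{real_inner, banach, second_countable_topology}"
  assumes u: "u \<in> borel_measurable M" "(\<lambda>x. norm (u x)) \<in> L2 M"
    and v: "v \<in> borel_measurable M" "(\<lambda>x. norm (v x)) \<in> L2 M"
  shows "a \<bullet> cov_op M u v b = cov M (\<lambda>x. a \<bullet> u x) (\<lambda>x. b \<bullet> v x)"
proof -
  note iu = norm_L2_integrable[OF u] and iv = norm_L2_integrable[OF v]
  have int: "integrable M (\<lambda>x. ((v x - expectation v) \<bullet> b) *\<^sub>R (u x - expectation u))"
    using u v inner_L2[OF _ norm_L2_diff_const[OF v], of "expectation v" b]
    by (intro L2_norm_integrable_scaleR norm_L2_diff_const[OF u]) (auto simp: inner_commute)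
  show ?thesis
    unfolding cov_op_def cov_def using iu iv
    by (subst integral_inner_right[symmetric, OF int])
       (auto intro!: Bochner_Integration.integral_cong simp: inner_diff inner_commute mult.commute)
qed

lemma bounded_linear_cov_op:
  fixes u :: "'a \<Rightarrow> 'b::{real_inner, banach, second_countable_topology}"
    and v :: "'a \<Rightarrow> 'c::{real_inner, banach, second_countable_topology}"
  assumes u: "u \<in> borel_measurable M" "(\<lambda>x. norm (u x)) \<in> L2 M"
    and v: "v \<in> borel_measurable M" "(\<lambda>x. norm (v x)) \<in> L2 M"
  shows "bounded_linear (cov_op M u v)"
proof -
  define u' where "u' x = u x - expectation u" for x
  define v' where "v' x = v x - expectation v" for x
  have u': "u' \<in> borel_measurable M" "(\<lambda>x. norm (u' x)) \<in> L2 M"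
    and v': "v' \<in> borel_measurable M" "(\<lambda>x. norm (v' x)) \<in> L2 M"
    using u v norm_L2_diff_const[OF u] norm_L2_diff_const[OF v] by (simp_all add: u'_def[abs_def] v'_def[abs_def])
  have int: "integrable M (\<lambda>x. (v' x \<bullet> b) *\<^sub>R u' x)" for b
    using inner_L2[OF v', of b] u' by (intro L2_norm_integrable_scaleR) (auto simp: inner_commute)
  have op: "cov_op M u v b = expectation (\<lambda>x. (v' x \<bullet> b) *\<^sub>R u' x)" for b
    by (simp add: cov_op_def u'_def v'_def)
  show ?thesis
  proof (rule bounded_linear_intro)
    show "cov_op M u v (b + b') = cov_op M u v b + cov_op M u v b'" for b b'
      unfolding op using int by (simp add: inner_add_right scaleR_add_left)
    show "cov_op M u v (c *\<^sub>R b) = c *\<^sub>R cov_op M u v b" for c b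
      unfolding op by (simp flip: scaleR_scaleR)
    show "norm (cov_op M u v b) \<le> norm b * expectation (\<lambda>x. norm (v' x) * norm (u' x))" for b
    proof -
      have "norm (cov_op M u v b) \<le> expectation (\<lambda>x. norm ((v' x \<bullet> b) *\<^sub>R u' x))"
        unfolding op by (rule integral_norm_bound)
      also have "\<dots> \<le> expectation (\<lambda>x. norm b * (norm (v' x) * norm (u' x)))"
      proof (rule integral_mono)
        show "integrable M (\<lambda>x. norm ((v' x \<bullet> b) *\<^sub>R u' x))" using int by (rule integrable_norm)
        show "integrable M (\<lambda>x. norm b * (norm (v' x) * norm (u' x)))"
          using L2_mult_integrable[OF v'(2) u'(2)] by simp
        show "norm ((v' x \<bullet> b) *\<^sub>R u' x) \<le> norm b * (norm (v' x) * norm (u' x))" for x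
          using mult_right_mono[OF Cauchy_Schwarz_ineq2[of "v' x" b], of "norm (u' x)"]
          by (simp add: ac_simps)
      qed
      finally show ?thesis by simp
    qed
  qed
qed

section \<open>Variables uncorrelated with a rich class are constant\<close>

text \<open>If \<open>r\<close> is centred and uncorrelated with all \<open>\<langle>h, \<phi>\<rangle>\<close>, then \<open>\<integral> r \<phi> dP = 0\<close>. The densities proportional to
  \<open>\<bar>r\<bar>\<close> and \<open>\<bar>r\<bar> + r\<close> then have the same total mass and the same mean embedding. A characteristic kernel
  forces them to coincide, that is, \<open>r = 0\<close>.\<close>

lemma characteristic_uncorrelated_const:
  fixes \<phi> :: "'a \<Rightarrow> 'h::{real_inner, banach, second_countable_topology}"
  assumes char: "characteristic N \<phi>" and sets: "sets M = sets N"
    and \<phi>: "\<phi> \<in> borel_measurable M" "(\<lambda>x. norm (\<phi> x)) \<in> L2 M" and r: "r \<in> L2 M"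
    and unc: "\<And>h. cov M r (\<lambda>x. h \<bullet> \<phi> x) = 0"
  shows "AE x in M. r x = expectation r"
proof -
  define r0 where "r0 x = r x - expectation r" for x
  have r0: "r0 \<in> L2 M" unfolding r0_def[abs_def] using r L2_const by (rule L2_diff)
  have E0: "expectation r0 = 0"
    using L2_integrable[OF r] by (simp add: r0_def[abs_def] prob_space)
  have int0: "integrable M (\<lambda>x. r0 x *\<^sub>R \<phi> x)" by (rule L2_norm_integrable_scaleR[OF r0 \<phi>])
  have "h \<bullet> expectation (\<lambda>x. r0 x *\<^sub>R \<phi> x) = 0" for h
  proof -
    have h: "(\<lambda>x. h \<bullet> \<phi> x) \<in> L2 M" by (rule inner_L2[OF \<phi>])
    have "cov M r0 (\<lambda>x. h \<bullet> \<phi> x) = cov M r (\<lambda>x. h \<bullet> \<phi> x)"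
      unfolding r0_def[abs_def] using cov_diff_left[OF r L2_const h]
      by (simp add: cov_eq[OF L2_const h] prob_space)
    with E0 unc show ?thesis
      by (simp add: cov_eq[OF r0 h] integral_inner_right[symmetric, OF int0])
  qed
  then have mean0: "expectation (\<lambda>x. r0 x *\<^sub>R \<phi> x) = 0" by (metis inner_eq_zero_iff)
  define c where "c = expectation (\<lambda>x. \<bar>r0 x\<bar>)"
  have abs_int: "integrable M (\<lambda>x. \<bar>r0 x\<bar>)" using L2_integrable[OF r0] by simp
  have "AE x in M. r0 x = 0"
  proof (cases "c = 0")
    case True
    then have "AE x in M. \<bar>r0 x\<bar> = 0"
      unfolding c_def by (subst (asm) integral_nonneg_eq_0_iff_AE[OF abs_int]) auto
    then show ?thesis by simp
  next
    case False
    moreover have "0 \<le> c" unfolding c_def by simp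
    ultimately have c: "0 < c" by simp
    have dens: "density M w \<in> {Q. sets Q = sets N \<and> prob_space Q \<and> integrable Q (\<lambda>x. norm (\<phi> x))}"
        "(LINT x|density M w. \<phi> x) = expectation (\<lambda>x. w x *\<^sub>R \<phi> x)"
      if w: "w \<in> L2 M" "\<And>x. 0 \<le> w x" "expectation w = 1" for w :: "'a \<Rightarrow> real"
    proof -
      have [measurable]: "w \<in> borel_measurable M" using w by (simp add: L2_def)
      have "prob_space (density M w)"
        using w by (intro prob_spaceI)
          (simp add: emeasure_density nn_integral_eq_integral L2_integrable cong: nn_integral_cong)
      moreover have "integrable (density M w) (\<lambda>x. norm (\<phi> x))"
        using w \<phi> L2_mult_integrable[OF w(1) \<phi>(2)] by (simp add: integrable_density)
      ultimately show "density M w \<in> {Q. sets Q = sets N \<and> prob_space Q \<and> integrable Q (\<lambda>x. norm (\<phi> x))}"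
        by (simp add: sets)
      show "(LINT x|density M w. \<phi> x) = expectation (\<lambda>x. w x *\<^sub>R \<phi> x)"
        using w \<phi> by (subst integral_density) auto
    qed
    define w1 where "w1 x = (1 / c) * \<bar>r0 x\<bar>" for x
    define w2 where "w2 x = (1 / c) * (\<bar>r0 x\<bar> + r0 x)" for x
    have w1: "w1 \<in> L2 M" unfolding w1_def[abs_def] by (intro L2_cmult L2_abs r0)
    have w2: "w2 \<in> L2 M" unfolding w2_def[abs_def] by (intro L2_cmult L2_add L2_abs r0)
    have "0 \<le> w1 x" "expectation w1 = 1" for x
      using c unfolding w1_def[abs_def] by (simp_all add: c_def[symmetric])
    note w1 = w1 this
    have "0 \<le> w2 x" "expectation w2 = 1" for x
      using c abs_int L2_integrable[OF r0] unfolding w2_def[abs_def]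
      by (simp_all add: E0 c_def[symmetric])
    note w2 = w2 this
    have "(LINT x|density M w1. \<phi> x) = (LINT x|density M w2. \<phi> x)"
    proof -
      have "expectation (\<lambda>x. w2 x *\<^sub>R \<phi> x) = expectation (\<lambda>x. w1 x *\<^sub>R \<phi> x + (1 / c) *\<^sub>R (r0 x *\<^sub>R \<phi> x))"
        by (intro Bochner_Integration.integral_cong)
           (auto simp: w1_def w2_def distrib_left scaleR_add_left)
      also have "\<dots> = expectation (\<lambda>x. w1 x *\<^sub>R \<phi> x)"
        by (simp only: Bochner_Integration.integral_add[OF L2_norm_integrable_scaleR[OF w1(1) \<phi>]
              integrable_scaleR_right[OF int0]] integral_scaleR_right mean0) simp
      finally show ?thesis using dens(2)[OF w1] dens(2)[OF w2] by simp
    qed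
    with char have "density M w1 = density M w2"
      unfolding characteristic_def using dens(1)[OF w1] dens(1)[OF w2] by (blast dest: inj_onD)
    moreover have "(\<integral>\<^sup>+x. ennreal (w1 x) \<partial>M) = 1"
      using w1 by (simp add: nn_integral_eq_integral L2_integrable)
    ultimately have "AE x in M. ennreal (w1 x) = ennreal (w2 x)"
      using w1(1) w2(1) by (subst finite_density_unique[symmetric]) (auto simp: L2_def)
    then show ?thesis
      by eventually_elim (use c w1(2) w2(2) in \<open>simp add: w1_def w2_def\<close>)
  qed
  then show ?thesis by eventually_elim (simp add: r0_def)
qed

text \<open>Norm and difference in the quotient are computed on chosen representatives, which differ from the given
  ones by a constant.\<close>

lemma L2C_class_some:
  assumes f: "f \<in> L2 M"
  shows "(SOME g. g \<in> L2C_class M f) \<in> L2 M" 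
    and "\<exists>c. AE x in M. f x - (SOME g. g \<in> L2C_class M f) x = c"
proof -
  have "f \<in> L2C_class M f" using f by (auto simp: L2C_class_def eq_mod_const_def)
  then have "(SOME g. g \<in> L2C_class M f) \<in> L2C_class M f" by (rule someI[of "\<lambda>g. g \<in> L2C_class M f"])
  then show "(SOME g. g \<in> L2C_class M f) \<in> L2 M" 
    and "\<exists>c. AE x in M. f x - (SOME g. g \<in> L2C_class M f) x = c"
    by (auto simp: L2C_class_def eq_mod_const_def)
qed

lemma L2C_norm_class:
  assumes f: "f \<in> L2 M"
  shows "L2C_norm M (L2C_class M f) = sqrt (cov M f f)"
  unfolding L2C_norm_def L2C_inner_def
  using L2C_class_some[OF f] cov_self_cong_const[OF f] by metis

lemma L2C_norm_minus:
  assumes f: "f \<in> L2 M" and g: "g \<in> L2 M"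
  shows "L2C_norm M (L2C_minus M (L2C_class M f) (L2C_class M g)) = sqrt (cov M (\<lambda>x. f x - g x) (\<lambda>x. f x - g x))"
proof -
  define f' where "f' = (SOME h. h \<in> L2C_class M f)"
  define g' where "g' = (SOME h. h \<in> L2C_class M g)"
  have f': "f' \<in> L2 M" and g': "g' \<in> L2 M" unfolding f'_def g'_def using f g by (auto intro: L2C_class_some)
  obtain a b where a: "AE x in M. f x - f' x = a" and b: "AE x in M. g x - g' x = b"
    unfolding f'_def g'_def using L2C_class_some(2)[OF f] L2C_class_some(2)[OF g] by blast
  have c: "AE x in M. (f x - g x) - (f' x - g' x) = a - b"
    using a b by eventually_elim simp
  show ?thesis
    unfolding L2C_minus_def f'_def[symmetric] g'_def[symmetric] L2C_norm_class[OF L2_diff[OF f' g']]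
    using cov_self_cong_const[OF L2_diff[OF f g] L2_diff[OF f' g'] c] by simp
qed

text \<open>By Pythagoras, no element of the given family is closer to the class of \<open>r\<close> than the zero class.\<close>

lemma dense_uncorrelated_const:
  assumes dense: "dense_in_L2C M {L2C_class M (e h) |h. True}"
    and e: "\<And>h. e h \<in> L2 M" and r: "r \<in> L2 M" and unc: "\<And>h. cov M r (e h) = 0"
  shows "AE x in M. r x = expectation r"
proof (rule cov_self_eq_0_imp_const[OF r], rule ccontr)
  assume "cov M r r \<noteq> 0"
  then have pos: "0 < sqrt (cov M r r)" using cov_self_nonneg[of r] by simp
  have "L2C_class M r \<in> L2C M" using r unfolding L2C_def L2C_class_def by (rule quotientI)
  then obtain h where "L2C_norm M (L2C_minus M (L2C_class M r) (L2C_class M (e h))) < sqrt (cov M r r)"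
    using dense pos unfolding dense_in_L2C_def by blast
  then have "cov M (\<lambda>x. r x - e h x) (\<lambda>x. r x - e h x) < cov M r r"
    by (simp add: L2C_norm_minus[OF r e])
  also have "cov M (\<lambda>x. r x - e h x) (\<lambda>x. r x - e h x) = cov M r r + cov M (e h) (e h)"
    using unc[of h] cov_commute[of M r "e h"]
    by (simp add: cov_diff_left cov_diff_right L2_diff r e)
  finally show False using cov_self_nonneg[of "e h"] by simp
qed

end

section \<open>Conditional mean embeddings as conditional expectations\<close>

lemma (in prob_space) L2_distr:
  assumes X: "X \<in> M \<rightarrow>\<^sub>M N" and f: "f \<in> borel_measurable N"
  shows "f \<in> L2 (distr M N X) \<longleftrightarrow> (\<lambda>\<omega>. f (X \<omega>)) \<in> L2 M"
  using assms measurable_compose[OF X f] by (simp add: L2_def integrable_distr_eq)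

lemma cov_op_distr:
  assumes X: "X \<in> M \<rightarrow>\<^sub>M N" and u: "u \<in> borel_measurable N" and v: "v \<in> borel_measurable N"
  shows "cov_op (distr M N X) u v = cov_op M (\<lambda>\<omega>. u (X \<omega>)) (\<lambda>\<omega>. v (X \<omega>))"
  unfolding cov_op_def using assms by (simp add: integral_distr)

text \<open>The vector \<open>\<psi>(Y)\<close> models the response embedded by a feature map. The locale serves to replace it by its
  conditional mean in all covariances with functions of \<open>X\<close>.\<close>

locale embedded_response = prob_space M
  for M :: "'w measure" +
  fixes MX :: "'x measure" and X :: "'w \<Rightarrow> 'x" and MY :: "'y measure" and Y :: "'w \<Rightarrow> 'y"
    and \<kappa> :: "'x \<Rightarrow> 'y measure"
    and \<psi> :: "'y \<Rightarrow> 'g::{real_inner, banach, second_countable_topology}"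
  assumes X[measurable]: "X \<in> M \<rightarrow>\<^sub>M MX" and Y[measurable]: "Y \<in> M \<rightarrow>\<^sub>M MY"
    and rcd: "regular_cond_distr M MX X MY Y \<kappa>"
    and \<psi>_meas[measurable]: "\<psi> \<in> borel_measurable MY"
    and \<psi>_L2: "(\<lambda>\<omega>. norm (\<psi> (Y \<omega>))) \<in> L2 M"
begin

abbreviation "P \<equiv> distr M MX X"
abbreviation "m \<equiv> cond_mean MX \<kappa> \<psi>"
abbreviation "fin \<equiv> finite_cond_moment_set MX \<kappa> \<psi>"

sublocale PX: prob_space P by (rule prob_space_distr[OF X])

lemma kernel_measurable[measurable]: "\<kappa> \<in> MX \<rightarrow>\<^sub>M subprob_algebra MY"
  using rcd by (auto simp: regular_cond_distr_def intro: measurable_prob_algebraD)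

lemma sets_kernel: "x \<in> space MX \<Longrightarrow> sets (\<kappa> x) = sets MY"
  using subprob_measurableD(2)[OF kernel_measurable] by simp

lemma prob_space_kernel: "x \<in> space MX \<Longrightarrow> prob_space (\<kappa> x)"
  using rcd measurable_space[of \<kappa> MX "prob_algebra MY" x]
  by (auto simp: regular_cond_distr_def space_prob_algebra)

lemma second_moment_measurable[measurable]:
  "(\<lambda>x. \<integral>\<^sup>+y. ennreal ((norm (\<psi> y))\<^sup>2) \<partial>\<kappa> x) \<in> borel_measurable MX"
  by (rule measurable_compose[OF kernel_measurable nn_integral_measurable_subprob_algebra]) measurable

lemma fin_measurable[measurable]: "fin \<in> sets MX"
  unfolding finite_cond_moment_set_def by measurable

lemma second_moment_finite: "(\<integral>\<^sup>+x. \<integral>\<^sup>+y. ennreal ((norm (\<psi> y))\<^sup>2) \<partial>\<kappa> x \<partial>P) < \<infinity>"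
proof -
  have "(\<integral>\<^sup>+x. \<integral>\<^sup>+y. ennreal ((norm (\<psi> y))\<^sup>2) \<partial>\<kappa> x \<partial>P) = (\<integral>\<^sup>+\<omega>. ennreal ((norm (\<psi> (Y \<omega>)))\<^sup>2) \<partial>M)"
    using regular_cond_distr_nn_integral[OF X Y prob_space_axioms rcd, of "\<lambda>z. ennreal ((norm (\<psi> (snd z)))\<^sup>2)"]
    by simp
  also have "\<dots> < \<infinity>"
    using \<psi>_L2 by (simp add: L2_def real_integrable_def less_top)
  finally show ?thesis .
qed

lemma AE_fin: "AE x in P. x \<in> fin"
proof -
  have "AE x in P. (\<integral>\<^sup>+y. ennreal ((norm (\<psi> y))\<^sup>2) \<partial>\<kappa> x) \<noteq> \<infinity>"
    using second_moment_finite by (intro nn_integral_noteq_infinite) (auto simp: less_top)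
  with AE_space show ?thesis
    by eventually_elim (simp add: finite_cond_moment_set_def less_top)
qed

lemma fin_L2:
  assumes x: "x \<in> fin"
  shows "\<psi> \<in> borel_measurable (\<kappa> x)" and "(\<lambda>y. norm (\<psi> y)) \<in> L2 (\<kappa> x)"
proof -
  have xs: "x \<in> space MX" and lt: "(\<integral>\<^sup>+y. ennreal ((norm (\<psi> y))\<^sup>2) \<partial>\<kappa> x) < \<infinity>"
    using x by (auto simp: finite_cond_moment_set_def)
  show 1: "\<psi> \<in> borel_measurable (\<kappa> x)"
    using \<psi>_meas by (simp add: measurable_cong_sets[OF sets_kernel[OF xs] refl])
  then show "(\<lambda>y. norm (\<psi> y)) \<in> L2 (\<kappa> x)"
    using lt by (simp add: L2_def integrableI_nonneg)
qed

lemma cond_mean_measurable[measurable]: "m \<in> borel_measurable MX"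
proof -
  have "(\<lambda>x. LINT y|\<kappa> x. \<psi> y) \<in> borel_measurable MX"
    by (rule measurable_compose[OF kernel_measurable integral_measurable_subprob_algebra]) measurable
  then show ?thesis unfolding cond_mean_def[abs_def]
    by (rule measurable_If_set) auto
qed

lemma inner_cond_mean:
  assumes x: "x \<in> fin"
  shows "g \<bullet> m x = (LINT y|\<kappa> x. g \<bullet> \<psi> y)"
proof -
  interpret K: prob_space "\<kappa> x"
    using x unfolding finite_cond_moment_set_def by (blast intro: prob_space_kernel)
  have "m x = (LINT y|\<kappa> x. \<psi> y)" using x by (simp only: cond_mean_def if_True)
  then show ?thesis
    by (simp only: integral_inner_right[OF K.norm_L2_integrable[OF fin_L2[OF x]]])
qed

text \<open>Jensen: \<open>(norm (m x))\<^sup>2\<close> is at most the conditional second moment, which is integrable.\<close>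

lemma cond_mean_L2: "(\<lambda>x. norm (m x)) \<in> L2 P"
proof -
  have Jensen: "ennreal ((norm (m x))\<^sup>2) \<le> (\<integral>\<^sup>+y. ennreal ((norm (\<psi> y))\<^sup>2) \<partial>\<kappa> x)" if x: "x \<in> fin" for x
  proof -
    interpret K: prob_space "\<kappa> x"
      using x unfolding finite_cond_moment_set_def by (blast intro: prob_space_kernel)
    note L2 = fin_L2[OF x]
    have int: "integrable (\<kappa> x) (\<lambda>y. (norm (\<psi> y))\<^sup>2)" "integrable (\<kappa> x) (\<lambda>y. norm (\<psi> y))"
      using L2(2) by (simp only: L2_def mem_Collect_eq) (rule K.L2_integrable[OF L2(2)])
    have "m x = (LINT y|\<kappa> x. \<psi> y)" using x by (simp only: cond_mean_def if_True)
    then have "norm (m x) \<le> (LINT y|\<kappa> x. norm (\<psi> y))"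
      by (simp only: integral_norm_bound)
    then have "(norm (m x))\<^sup>2 \<le> (LINT y|\<kappa> x. norm (\<psi> y))\<^sup>2"
      by (rule power_mono) simp
    also have "\<dots> \<le> (LINT y|\<kappa> x. (norm (\<psi> y))\<^sup>2)"
      using K.variance_eq[OF int(2,1)] K.variance_positive[of "\<lambda>y. norm (\<psi> y)"] by linarith
    finally have "ennreal ((norm (m x))\<^sup>2) \<le> ennreal (LINT y|\<kappa> x. (norm (\<psi> y))\<^sup>2)"
      by (rule ennreal_leI)
    also have "\<dots> = (\<integral>\<^sup>+y. ennreal ((norm (\<psi> y))\<^sup>2) \<partial>\<kappa> x)"
      by (rule nn_integral_eq_integral[symmetric, OF int(1)]) simp
    finally show ?thesis .
  qed
  have "AE x in P. ennreal ((norm (m x))\<^sup>2) \<le> (\<integral>\<^sup>+y. ennreal ((norm (\<psi> y))\<^sup>2) \<partial>\<kappa> x)"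
    using AE_fin by eventually_elim (rule Jensen)
  then have "(\<integral>\<^sup>+x. ennreal ((norm (m x))\<^sup>2) \<partial>P) \<le> (\<integral>\<^sup>+x. \<integral>\<^sup>+y. ennreal ((norm (\<psi> y))\<^sup>2) \<partial>\<kappa> x \<partial>P)"
    by (rule nn_integral_mono_AE)
  then have "(\<integral>\<^sup>+x. ennreal ((norm (m x))\<^sup>2) \<partial>P) < \<infinity>"
    using second_moment_finite by (rule order_le_less_trans)
  then have "integrable P (\<lambda>x. (norm (m x))\<^sup>2)" by (intro integrableI_nonneg) simp_all
  then show ?thesis by (simp add: L2_def)
qed

text \<open>This is the defining property of a conditional expectation: \<open>m(X)\<close> represents \<open>\<psi>(Y)\<close> against all
  square-integrable functions of \<open>X\<close>.\<close>

lemma integral_cond_mean: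
  assumes v: "v \<in> L2 P"
  shows "expectation (\<lambda>\<omega>. v (X \<omega>) * (g \<bullet> \<psi> (Y \<omega>))) = (LINT x|P. v x * (g \<bullet> m x))"
proof -
  have [measurable]: "v \<in> borel_measurable MX" using v by (simp add: L2_def)
  have "(\<lambda>\<omega>. v (X \<omega>)) \<in> L2 M" using v by (simp add: L2_distr)
  moreover have "(\<lambda>\<omega>. g \<bullet> \<psi> (Y \<omega>)) \<in> L2 M" using \<psi>_L2 by (intro inner_L2) simp_all
  ultimately have "integrable M (\<lambda>\<omega>. v (X \<omega>) * (g \<bullet> \<psi> (Y \<omega>)))" by (rule L2_mult_integrable)
  moreover have "(\<lambda>z. v (fst z) * (g \<bullet> \<psi> (snd z))) \<in> borel_measurable (MX \<Otimes>\<^sub>M MY)"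
    by measurable
  ultimately have "expectation (\<lambda>\<omega>. v (X \<omega>) * (g \<bullet> \<psi> (Y \<omega>))) = (LINT x|P. LINT y|\<kappa> x. v x * (g \<bullet> \<psi> y))"
    using regular_cond_distr_integral[OF X Y prob_space_axioms rcd, of "\<lambda>z. v (fst z) * (g \<bullet> \<psi> (snd z))"]
    unfolding fst_conv snd_conv by blast
  also have "\<dots> = (LINT x|P. v x * (LINT y|\<kappa> x. g \<bullet> \<psi> y))"
    by (rule Bochner_Integration.integral_cong[OF refl]) (rule integral_mult_right_zero)
  also have "\<dots> = (LINT x|P. v x * (g \<bullet> m x))"
  proof (rule integral_cong_AE)
    have "(\<lambda>x. LINT y|\<kappa> x. g \<bullet> \<psi> y) \<in> borel_measurable MX"
      by (rule measurable_compose[OF kernel_measurable integral_measurable_subprob_algebra]) measurable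
    then show "(\<lambda>x. v x * (LINT y|\<kappa> x. g \<bullet> \<psi> y)) \<in> borel_measurable P" by simp
    show "AE x in P. v x * (LINT y|\<kappa> x. g \<bullet> \<psi> y) = v x * (g \<bullet> m x)"
      using AE_fin by eventually_elim (simp only: inner_cond_mean)
    show "(\<lambda>x. v x * (g \<bullet> m x)) \<in> borel_measurable P" by simp
  qed
  finally show ?thesis .
qed

lemma expectation_cond_mean: "expectation (\<lambda>\<omega>. \<psi> (Y \<omega>)) = (LINT x|P. m x)"
proof (rule vector_eq_ldot[THEN iffD1], rule allI)
  fix g
  have 1: "integrable M (\<lambda>\<omega>. \<psi> (Y \<omega>))" using \<psi>_L2 by (intro norm_L2_integrable) simp_all
  have 2: "integrable P m" using cond_mean_L2 by (intro PX.norm_L2_integrable) simp_all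
  have "expectation (\<lambda>\<omega>. g \<bullet> \<psi> (Y \<omega>)) = (LINT x|P. g \<bullet> m x)"
    using integral_cond_mean[OF PX.L2_const[of 1], of g] by (simp only: mult_1_left)
  then show "g \<bullet> expectation (\<lambda>\<omega>. \<psi> (Y \<omega>)) = g \<bullet> (LINT x|P. m x)"
    by (simp only: integral_inner_right[OF 1] integral_inner_right[OF 2])
qed

lemma cov_cond_mean:
  assumes v: "v \<in> L2 P"
  shows "cov M (\<lambda>\<omega>. v (X \<omega>)) (\<lambda>\<omega>. g \<bullet> \<psi> (Y \<omega>)) = cov P v (\<lambda>x. g \<bullet> m x)"
proof -
  have vm: "v \<in> borel_measurable MX" using v by (simp add: L2_def)
  have "(\<lambda>\<omega>. v (X \<omega>)) \<in> L2 M" using v vm by (simp add: L2_distr)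
  moreover have "(\<lambda>\<omega>. g \<bullet> \<psi> (Y \<omega>)) \<in> L2 M" using \<psi>_L2 by (intro inner_L2) simp_all
  moreover have "(\<lambda>x. g \<bullet> m x) \<in> L2 P" using cond_mean_L2 by (intro PX.inner_L2) simp_all
  ultimately show ?thesis
    using integral_cond_mean[OF v, of g] integral_cond_mean[OF PX.L2_const[of 1], of g] v vm
    by (simp add: cov_eq PX.cov_eq integral_distr)
qed

lemma cov_op_cond_mean:
  fixes u :: "'x \<Rightarrow> 'h::{real_inner, banach, second_countable_topology}"
  assumes u: "u \<in> borel_measurable MX" "(\<lambda>x. norm (u x)) \<in> L2 P"
  shows "cov_op M (\<lambda>\<omega>. u (X \<omega>)) (\<lambda>\<omega>. \<psi> (Y \<omega>)) = cov_op P u m"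
proof (rule ext, rule vector_eq_ldot[THEN iffD1], rule allI)
  fix b a
  note [measurable] = u(1)
  have "(\<lambda>\<omega>. norm (u (X \<omega>))) \<in> L2 M" using u by (simp add: L2_distr)
  then have "a \<bullet> cov_op M (\<lambda>\<omega>. u (X \<omega>)) (\<lambda>\<omega>. \<psi> (Y \<omega>)) b = cov M (\<lambda>\<omega>. a \<bullet> u (X \<omega>)) (\<lambda>\<omega>. b \<bullet> \<psi> (Y \<omega>))"
    using \<psi>_L2 by (intro inner_cov_op) simp_all
  also have "\<dots> = cov P (\<lambda>x. a \<bullet> u x) (\<lambda>x. b \<bullet> m x)"
    using u by (intro cov_cond_mean PX.inner_L2) simp_all
  also have "\<dots> = a \<bullet> cov_op P u m b"
    using u cond_mean_L2 by (intro PX.inner_cov_op[symmetric]) simp_all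
  finally show "a \<bullet> cov_op M (\<lambda>\<omega>. u (X \<omega>)) (\<lambda>\<omega>. \<psi> (Y \<omega>)) b = a \<bullet> cov_op P u m b" .
qed

end

section \<open>Linear regression in Hilbert space\<close>

text \<open>Closedness holds although the exceptional null set depends on \<open>g\<close>: a limit involves only countably many
  null sets.\<close>

lemma AE_orthogonal_subspace:
  fixes R :: "'a \<Rightarrow> 'g::real_inner"
  shows "subspace {g. AE x in M. g \<bullet> R x = 0}" and "closed {g. AE x in M. g \<bullet> R x = 0}"
proof -
  let ?V = "{g. AE x in M. g \<bullet> R x = 0}"
  show "subspace ?V"
  proof (rule subspaceI)
    show "g + g' \<in> ?V" if "g \<in> ?V" "g' \<in> ?V" for g g'
    proof -
      have "AE x in M. g \<bullet> R x = 0" "AE x in M. g' \<bullet> R x = 0" using that by auto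
      then have "AE x in M. (g + g') \<bullet> R x = 0" by eventually_elim (simp add: inner_add_left)
      then show ?thesis by simp
    qed
  qed auto
  show "closed ?V" unfolding closed_sequential_limits
  proof (intro allI impI)
    fix u l assume u: "(\<forall>n. u n \<in> ?V) \<and> u \<longlonglongrightarrow> l"
    then have "AE x in M. \<forall>n. u n \<bullet> R x = 0" by (simp add: AE_all_countable)
    then have "AE x in M. l \<bullet> R x = 0"
    proof eventually_elim
      case (elim x)
      have "(\<lambda>n. u n \<bullet> R x) \<longlonglongrightarrow> l \<bullet> R x" using u by (intro tendsto_inner tendsto_const) simp
      with elim show ?case by (simp add: LIMSEQ_const_iff)
    qed
    then show "l \<in> ?V" by simp
  qed
qed

text \<open>Separability again reduces uncountably many null sets to countably many.\<close>

lemma AE_eq_0_weak: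
  fixes R :: "'a \<Rightarrow> 'g::{real_inner, second_countable_topology}"
  assumes R: "\<And>g. AE x in M. g \<bullet> R x = 0"
  shows "AE x in M. R x = 0"
proof -
  obtain D :: "'g set" where D: "countable D" "\<And>U. open U \<Longrightarrow> U \<noteq> {} \<Longrightarrow> \<exists>d\<in>D. d \<in> U"
    using countable_dense_setE by blast
  have "AE x in M. \<forall>d\<in>D. d \<bullet> R x = 0" using D(1) R by (simp add: AE_ball_countable)
  then show ?thesis
  proof eventually_elim
    case (elim x)
    have "open {d. d \<bullet> R x \<noteq> 0}" by (intro open_Collect_neq continuous_intros)
    then have "{d. d \<bullet> R x \<noteq> 0} = {}" using D(2) elim by blast
    then have "R x \<bullet> R x = 0" by blast
    then show ?case by simp
  qed
qed

text \<open>Best affine prediction of \<open>m\<close> from \<open>\<phi>\<close>, where the normal equations are assumed to be solvable in every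
  direction \<open>g\<close>. The solution \<open>h\<close> is determined only up to the kernel of \<open>C\<close>; the pseudo-inverse makes a
  choice that is linear in \<open>g\<close>.\<close>

locale linear_regression = prob_space M
  for M :: "'x measure" +
  fixes \<phi> :: "'x \<Rightarrow> 'h::{real_inner, banach, second_countable_topology}"
    and m :: "'x \<Rightarrow> 'g::{real_inner, banach, second_countable_topology}"
  assumes \<phi>: "\<phi> \<in> borel_measurable M" "(\<lambda>x. norm (\<phi> x)) \<in> L2 M"
    and m: "m \<in> borel_measurable M" "(\<lambda>x. norm (m x)) \<in> L2 M"
    and normal_eq: "\<And>g. \<exists>h. \<forall>h'. cov M (\<lambda>x. h \<bullet> \<phi> x - g \<bullet> m x) (\<lambda>x. h' \<bullet> \<phi> x) = 0"
begin

abbreviation "C \<equiv> cov_op M \<phi> \<phi>"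
abbreviation "D \<equiv> cov_op M \<phi> m"
definition "coefficient g = pinv C (D g)"
definition "predictor x = expectation m + adjoint coefficient (\<phi> x - expectation \<phi>)"
definition "residual g x = g \<bullet> m x - coefficient g \<bullet> \<phi> x"

lemmas \<phi>_L2 = inner_L2[OF \<phi>] and m_L2 = inner_L2[OF m]

text \<open>Tested against vectors, the normal equations in direction \<open>g\<close> read \<open>C h = D g\<close>.\<close>

lemma cross_cov_in_range: "D g \<in> range C"
proof -
  obtain h where h: "\<And>h'. cov M (\<lambda>x. h \<bullet> \<phi> x - g \<bullet> m x) (\<lambda>x. h' \<bullet> \<phi> x) = 0"
    using normal_eq by blast
  have "a \<bullet> D g = a \<bullet> C h" for a
    using h[of a] by (simp add: inner_cov_op[OF \<phi> m] inner_cov_op[OF \<phi> \<phi>] cov_diff_left \<phi>_L2 m_L2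
        cov_commute[of M "\<lambda>x. a \<bullet> \<phi> x"])
  then have "D g = C h" by (metis vector_eq_ldot)
  then show ?thesis by blast
qed

lemma bounded_linear_coefficient: "bounded_linear coefficient"
  unfolding coefficient_def[abs_def]
  by (intro bounded_linear_pinv_comp bounded_linear_cov_op \<phi> m) (auto intro: cross_cov_in_range)

lemma residual_L2: "residual g \<in> L2 M"
  unfolding residual_def[abs_def] by (intro L2_diff \<phi>_L2 m_L2)

text \<open>This is \<open>C (coefficient g) = D g\<close>, read as an identity of bilinear forms.\<close>

lemma residual_uncorrelated: "cov M (residual g) (\<lambda>x. h \<bullet> \<phi> x) = 0"
proof -
  have "C (coefficient g) = D g"
    unfolding coefficient_def by (rule pinv_range(1)[OF bounded_linear_cov_op[OF \<phi> \<phi>] cross_cov_in_range])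
  then have "h \<bullet> D g - h \<bullet> C (coefficient g) = 0" by simp
  then show ?thesis
    unfolding residual_def[abs_def]
    by (simp add: inner_cov_op[OF \<phi> m] inner_cov_op[OF \<phi> \<phi>] cov_diff_left \<phi>_L2 m_L2
        cov_commute[of M "\<lambda>x. h \<bullet> \<phi> x"])
qed

text \<open>The adjoint moves the coefficient operator from \<open>\<phi>\<close> to \<open>g\<close>, so every scalar component of the vector-valued
  prediction error is a centred residual.\<close>

lemma inner_prediction_error: "g \<bullet> (m x - predictor x) = residual g x - expectation (residual g)"
proof -
  have "expectation (residual g) = g \<bullet> expectation m - coefficient g \<bullet> expectation \<phi>"
    unfolding residual_def[abs_def]
    by (simp add: L2_integrable[OF \<phi>_L2] L2_integrable[OF m_L2] norm_L2_integrable[OF \<phi>] norm_L2_integrable[OF m])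
  then show ?thesis
    by (simp add: predictor_def residual_def inner_diff_right inner_add_right
        inner_adjoint[OF bounded_linear_coefficient, symmetric])
qed

text \<open>The prediction error in direction \<open>g\<close> is a centred residual, which is orthogonal to all \<open>\<langle>h, \<phi>\<rangle>\<close>.\<close>

lemma weak_prediction:
  "expectation (\<lambda>x. (h \<bullet> \<phi> x) * (g \<bullet> m x)) = expectation (\<lambda>x. (h \<bullet> \<phi> x) * (g \<bullet> predictor x))"
proof -
  let ?f = "\<lambda>x. h \<bullet> \<phi> x" and ?r = "residual g"
  have int: "integrable M (\<lambda>x. ?f x * (g \<bullet> m x))" "integrable M (\<lambda>x. ?f x * ?r x)"
      "integrable M (\<lambda>x. expectation ?r * ?f x)"
    by (intro L2_mult_integrable \<phi>_L2 m_L2 residual_L2 integrable_mult_right L2_integrable)+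
  have eq: "?f x * (g \<bullet> predictor x) = ?f x * (g \<bullet> m x) - (?f x * ?r x - expectation ?r * ?f x)" for x
  proof -
    have "g \<bullet> predictor x = g \<bullet> m x - (?r x - expectation ?r)"
      using inner_prediction_error[of g x] by (simp add: inner_diff_right)
    then show ?thesis by (simp only:) (simp add: algebra_simps)
  qed
  have "expectation (\<lambda>x. ?f x * (g \<bullet> predictor x))
      = expectation (\<lambda>x. ?f x * (g \<bullet> m x)) - (expectation (\<lambda>x. ?f x * ?r x) - expectation (\<lambda>x. expectation ?r * ?f x))"
    unfolding eq using int
    by (subst Bochner_Integration.integral_diff) (auto simp del: integral_mult_right_zero)
  also have "expectation (\<lambda>x. ?f x * ?r x) - expectation (\<lambda>x. expectation ?r * ?f x) = cov M ?f ?r"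
    by (simp add: cov_eq[OF \<phi>_L2 residual_L2])
  also have "cov M ?f ?r = 0" using residual_uncorrelated[of g h] by (simp add: cov_commute)
  finally show ?thesis by simp
qed

text \<open>If \<open>\<langle>g, m\<rangle>\<close> is an affine function of \<open>\<phi>\<close>, then the residual is, up to a constant, one of the
  variables with which it is uncorrelated. Hence its variance vanishes.\<close>

lemma residual_const_if_fitted:
  assumes "AE x in M. h \<bullet> \<phi> x - g \<bullet> m x = c"
  shows "AE x in M. residual g x = expectation (residual g)"
proof (rule cov_self_eq_0_imp_const[OF residual_L2])
  have "AE x in M. residual g x - (h - coefficient g) \<bullet> \<phi> x = - c"
    using assms by eventually_elim (simp add: residual_def inner_diff_left)
  then have "cov M (residual g) (residual g) = cov M (residual g) (\<lambda>x. (h - coefficient g) \<bullet> \<phi> x)"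
    by (rule cov_cong_const_right[OF residual_L2 residual_L2 \<phi>_L2])
  then show "cov M (residual g) (residual g) = 0" by (simp add: residual_uncorrelated)
qed

text \<open>The exact directions form a closed subspace, so it suffices to test a set \<open>S\<close> that is total.\<close>

lemma AE_eq_predictor:
  assumes G: "\<And>V. closed V \<Longrightarrow> subspace V \<Longrightarrow> S \<subseteq> V \<Longrightarrow> V = UNIV"
    and res: "\<And>g. g \<in> S \<Longrightarrow> AE x in M. residual g x = expectation (residual g)"
  shows "AE x in M. m x = predictor x"
proof -
  define V where "V = {g. AE x in M. g \<bullet> (m x - predictor x) = 0}"
  have "S \<subseteq> V"
  proof
    fix g assume "g \<in> S"
    then have "AE x in M. residual g x = expectation (residual g)" by (rule res)
    then have "AE x in M. g \<bullet> (m x - predictor x) = 0"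
      by eventually_elim (simp add: inner_prediction_error)
    then show "g \<in> V" by (simp only: V_def mem_Collect_eq)
  qed
  moreover have "closed V" "subspace V" unfolding V_def by (rule AE_orthogonal_subspace)+
  ultimately have "V = UNIV" by (intro G)
  then have "g \<in> V" for g by (simp only: UNIV_I)
  then have "AE x in M. g \<bullet> (m x - predictor x) = 0" for g by (simp only: V_def mem_Collect_eq)
  then have "AE x in M. m x - predictor x = 0" by (rule AE_eq_0_weak)
  then show ?thesis by simp
qed

end

section \<open>Conditional mean embeddings by linear regression\<close>

theorem theorem4p3:
  fixes M :: "'w measure" and MX :: "'x measure" and MY :: "'y measure"
    and X :: "'w \<Rightarrow> 'x" and Y :: "'w \<Rightarrow> 'y"
    and k :: "'x \<Rightarrow> 'x \<Rightarrow> real" and l :: "'y \<Rightarrow> 'y \<Rightarrow> real"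
    and evH :: "'h::{real_inner, banach, second_countable_topology} \<Rightarrow> 'x \<Rightarrow> real"
    and evG :: "'g::{real_inner, banach, second_countable_topology} \<Rightarrow> 'y \<Rightarrow> real"
    and \<kappa> :: "'x \<Rightarrow> 'y measure"
  defines "PX \<equiv> distr M MX X"
    and "\<phi> \<equiv> feature_map (space MX) k evH"
    and "\<psi> \<equiv> feature_map (space MY) l evG"
  defines "\<phi>X \<equiv> (\<lambda>\<omega>. \<phi> (X \<omega>))"
    and "\<psi>Y \<equiv> (\<lambda>\<omega>. \<psi> (Y \<omega>))"
  defines "\<mu>X \<equiv> (LINT \<omega>|M. \<phi>X \<omega>)"
    and "\<mu>Y \<equiv> (LINT \<omega>|M. \<psi>Y \<omega>)"
    and "CX \<equiv> cov_op M \<phi>X \<phi>X"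
    and "CXY \<equiv> cov_op M \<phi>X \<psi>Y"
    and "\<mu>YX \<equiv> cond_mean MX \<kappa> \<psi>"
    and "f \<equiv> cond_fun MX \<kappa> \<psi> evG"
    and "HC \<equiv> RKHS_mod_const PX evH"
  defines "B \<equiv> (\<lambda>g. pinv CX (CXY g))"
  assumes prob: "prob_space M"
    and borelY: "Borel_isomorphic_to_unit_interval_subset MY"
    and X: "X \<in> M \<rightarrow>\<^sub>M MX" and Y: "Y \<in> M \<rightarrow>\<^sub>M MY"
    and k: "sym_pd_kernel (space MX) k" and l: "sym_pd_kernel (space MY) l"
    and k_meas: "\<forall>x\<in>space MX. k x \<in> borel_measurable MX"
    and l_meas: "\<forall>y\<in>space MY. l y \<in> borel_measurable MY"
    and H: "is_RKHS (space MX) k evH" and G: "is_RKHS (space MY) l evG"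
    and rcd: "regular_cond_distr M MX X MY Y \<kappa>"
    and moments: "integrable M (\<lambda>\<omega>. (norm (\<phi>X \<omega>))\<^sup>2 + (norm (\<psi>Y \<omega>))\<^sup>2)"
    and inj_L2: "\<forall>h. (AE x in PX. evH h x = 0) \<longleftrightarrow> h = 0"
    and proj: "\<forall>g. \<exists>hg. \<forall>h. cov M (\<lambda>\<omega>. evH hg (X \<omega>) - f g (X \<omega>)) (\<lambda>\<omega>. evH h (X \<omega>)) = 0"
  shows "(\<forall>g. CXY g \<in> pinv_dom CX) \<and> bounded_linear B
    \<and> (\<forall>y\<in>space MY. \<forall>h.
          L2_inner PX (evH h) (\<lambda>x. evG (\<mu>YX x) y) =
          L2_inner PX (evH h) (\<lambda>x. evG (\<mu>Y + adjoint B (\<phi> x - \<mu>X)) y))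
    \<and> (characteristic MX \<phi>
        \<or> dense_in_L2C PX HC
        \<or> (\<forall>g. \<exists>hg c. AE x in PX. evH hg x = f g x - c)
        \<or> (\<forall>y\<in>space MY. L2C_class PX (f (\<psi> y)) \<in> HC)
       \<longrightarrow> (AE x in PX. \<mu>YX x = \<mu>Y + adjoint B (\<phi> x - \<mu>X)))"
proof -
  interpret prob_space M by (rule prob)
  have \<phi>_meas[measurable]: "\<phi> \<in> borel_measurable MX"
    unfolding \<phi>_def by (rule feature_map_measurable[OF H k_meas])
  have \<psi>_meas[measurable]: "\<psi> \<in> borel_measurable MY"
    unfolding \<psi>_def by (rule feature_map_measurable[OF G l_meas])
  note [measurable] = X Y
  have \<phi>X_L2: "(\<lambda>\<omega>. norm (\<phi> (X \<omega>))) \<in> L2 M"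
    by (rule L2_bound[OF _ moments]) (auto simp: \<phi>X_def)
  have \<psi>Y_L2: "(\<lambda>\<omega>. norm (\<psi> (Y \<omega>))) \<in> L2 M"
    by (rule L2_bound[OF _ moments]) (auto simp: \<psi>Y_def)
  interpret E: embedded_response M MX X MY Y \<kappa> \<psi>
    by unfold_locales (fact X Y rcd \<psi>_meas \<psi>Y_L2)+
  have sets_PX: "sets PX = sets MX" and space_PX: "space PX = space MX" by (simp_all add: PX_def)
  have \<phi>_P: "\<phi> \<in> borel_measurable PX" "(\<lambda>x. norm (\<phi> x)) \<in> L2 PX"
    using \<phi>X_L2 by (simp_all add: PX_def L2_distr[OF X])
  have m_P: "\<mu>YX \<in> borel_measurable PX" "(\<lambda>x. norm (\<mu>YX x)) \<in> L2 PX"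
    using E.cond_mean_measurable E.cond_mean_L2 by (simp_all add: PX_def \<mu>YX_def)
  have evH_eq: "evH h x = h \<bullet> \<phi> x" if "x \<in> space MX" for h x
    unfolding \<phi>_def by (rule feature_map_reproducing(1)[OF H that])
  have evG_eq: "evG g y = g \<bullet> \<psi> y" if "y \<in> space MY" for g y
    unfolding \<psi>_def by (rule feature_map_reproducing(1)[OF G that])
  have f_eq: "f g x = g \<bullet> \<mu>YX x" if x: "x \<in> space MX" for g x
  proof (cases "x \<in> finite_cond_moment_set MX \<kappa> \<psi>")
    case True
    have "f g x = (LINT y|\<kappa> x. evG g y)" using True by (simp only: f_def cond_fun_def if_True)
    also have "\<dots> = (LINT y|\<kappa> x. g \<bullet> \<psi> y)"
      using sets_eq_imp_space_eq[OF E.sets_kernel[OF x]]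
      by (intro Bochner_Integration.integral_cong) (simp_all only: evG_eq)
    also have "\<dots> = g \<bullet> \<mu>YX x" unfolding \<mu>YX_def by (rule E.inner_cond_mean[OF True, symmetric])
    finally show ?thesis .
  next
    case False
    then show ?thesis by (simp add: f_def cond_fun_def \<mu>YX_def cond_mean_def)
  qed
  interpret P: prob_space PX unfolding PX_def by (rule E.PX.prob_space_axioms)
  note P_inner = P.inner_L2[OF \<phi>_P] P.inner_L2[OF m_P]
  interpret R: linear_regression PX \<phi> \<mu>YX
  proof
    show "\<exists>h. \<forall>h'. cov PX (\<lambda>x. h \<bullet> \<phi> x - g \<bullet> \<mu>YX x) (\<lambda>x. h' \<bullet> \<phi> x) = 0" for g
    proof -
      obtain h where h: "\<And>h'. cov M (\<lambda>\<omega>. evH h (X \<omega>) - f g (X \<omega>)) (\<lambda>\<omega>. evH h' (X \<omega>)) = 0"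
        using proj by blast
      have "cov PX (\<lambda>x. h \<bullet> \<phi> x - g \<bullet> \<mu>YX x) (\<lambda>x. h' \<bullet> \<phi> x) = 0" for h'
      proof -
        have "cov PX (\<lambda>x. h \<bullet> \<phi> x - g \<bullet> \<mu>YX x) (\<lambda>x. h' \<bullet> \<phi> x)
            = cov M (\<lambda>\<omega>. h \<bullet> \<phi> (X \<omega>) - g \<bullet> \<mu>YX (X \<omega>)) (\<lambda>\<omega>. h' \<bullet> \<phi> (X \<omega>))"
          unfolding PX_def using m_P(1) by (intro cov_distr X) (simp_all add: PX_def)
        also have "\<dots> = cov M (\<lambda>\<omega>. evH h (X \<omega>) - f g (X \<omega>)) (\<lambda>\<omega>. evH h' (X \<omega>))"
          using measurable_space[OF X] by (intro cov_cong) (simp_all only: evH_eq f_eq)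
        finally show ?thesis by (simp only: h)
      qed
      then show ?thesis by blast
    qed
  qed (fact \<phi>_P m_P)+
  have CX: "CX = cov_op PX \<phi> \<phi>"
    unfolding CX_def \<phi>X_def PX_def by (rule cov_op_distr[OF X \<phi>_meas \<phi>_meas, symmetric])
  have CXY: "CXY = cov_op PX \<phi> \<mu>YX"
    unfolding CXY_def \<phi>X_def \<psi>Y_def PX_def \<mu>YX_def
    using \<phi>_P(2) by (intro E.cov_op_cond_mean \<phi>_meas) (simp add: PX_def)
  have \<mu>X: "\<mu>X = (LINT x|PX. \<phi> x)"
    unfolding \<mu>X_def \<phi>X_def PX_def by (rule integral_distr[OF X \<phi>_meas, symmetric])
  have \<mu>Y: "\<mu>Y = (LINT x|PX. \<mu>YX x)"
    unfolding \<mu>Y_def \<psi>Y_def PX_def \<mu>YX_def by (rule E.expectation_cond_mean)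
  have B: "B = R.coefficient"
    unfolding B_def CX CXY by (rule ext) (simp only: R.coefficient_def)
  have predictor: "\<mu>Y + adjoint B (\<phi> x - \<mu>X) = R.predictor x" for x
    by (simp only: B \<mu>X \<mu>Y R.predictor_def)

  have 1: "CXY g \<in> pinv_dom CX" for g
  proof -
    have "CXY g \<in> range CX" unfolding CX CXY by (rule R.cross_cov_in_range)
    moreover have "0 \<in> (range CX)\<^sup>\<bottom>" by (rule subspace_0[OF subspace_orthogonal_comp])
    ultimately show ?thesis unfolding pinv_dom_def by force
  qed
  have 2: "bounded_linear B" unfolding B by (rule R.bounded_linear_coefficient)
  have 3: "L2_inner PX (evH h) (\<lambda>x. evG (\<mu>YX x) y) = L2_inner PX (evH h) (\<lambda>x. evG (R.predictor x) y)"
    if y: "y \<in> space MY" for y h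
  proof -
    have eq: "L2_inner PX (evH h) (\<lambda>x. evG (u x) y) = (LINT x|PX. (h \<bullet> \<phi> x) * (\<psi> y \<bullet> u x))" for u
      unfolding L2_inner_def
      by (rule Bochner_Integration.integral_cong) (simp_all only: space_PX evH_eq evG_eq[OF y] inner_commute)
    show ?thesis unfolding eq by (rule R.weak_prediction)
  qed
  have 4: "AE x in PX. \<mu>YX x = R.predictor x"
    if cases: "characteristic MX \<phi> \<or> dense_in_L2C PX HC
        \<or> (\<forall>g. \<exists>hg c. AE x in PX. evH hg x = f g x - c)
        \<or> (\<forall>y\<in>space MY. L2C_class PX (f (\<psi> y)) \<in> HC)"
  proof (rule R.AE_eq_predictor[where S="\<psi> ` space MY"])
    fix V assume "closed V" "subspace V" "\<psi> ` space MY \<subseteq> V"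
    then show "V = UNIV" unfolding \<psi>_def by (intro feature_map_total[OF G]) auto
  next
    fix g assume "g \<in> \<psi> ` space MY"
    then obtain y where y: "y \<in> space MY" "g = \<psi> y" by blast
    have evH_L2: "evH h \<in> L2 PX" for h
    proof -
      have "evH h \<in> L2 PX \<longleftrightarrow> (\<lambda>x. h \<bullet> \<phi> x) \<in> L2 PX"
        by (rule L2_cong) (simp only: space_PX evH_eq)
      then show ?thesis using P_inner by blast
    qed
    have affine: "AE x in PX. R.residual g x = P.expectation (R.residual g)"
      if "AE x in PX. evH h x - f g x = c" for h c
    proof (rule R.residual_const_if_fitted)
      show "AE x in PX. h \<bullet> \<phi> x - g \<bullet> \<mu>YX x = c"
        using that AE_space by eventually_elim (simp only: space_PX evH_eq f_eq)
    qed
    from cases show "AE x in PX. R.residual g x = P.expectation (R.residual g)"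
    proof (elim disjE)
      assume "characteristic MX \<phi>"
      then show ?thesis
        by (rule P.characteristic_uncorrelated_const[OF _ sets_PX \<phi>_P R.residual_L2 R.residual_uncorrelated])
    next
      assume dense: "dense_in_L2C PX HC"
      show ?thesis
      proof (rule P.dense_uncorrelated_const[OF dense[unfolded HC_def RKHS_mod_const_def] _ R.residual_L2])
        show "evH h \<in> L2 PX" for h by (rule evH_L2)
        show "cov PX (R.residual g) (evH h) = 0" for h
          using cov_cong[of PX "R.residual g" "R.residual g" "evH h" "\<lambda>x. h \<bullet> \<phi> x"]
            R.residual_uncorrelated[of g h] by (simp only: space_PX evH_eq)
      qed
    next
      assume "\<forall>g. \<exists>hg c. AE x in PX. evH hg x = f g x - c"
      then obtain h c where "AE x in PX. evH h x = f g x - c" by blast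
      then have "AE x in PX. evH h x - f g x = - c" by eventually_elim simp
      then show ?thesis by (rule affine)
    next
      assume "\<forall>y\<in>space MY. L2C_class PX (f (\<psi> y)) \<in> HC"
      then obtain h where h: "L2C_class PX (evH h) = L2C_class PX (f g)"
        unfolding HC_def RKHS_mod_const_def using y by fastforce
      have "f g \<in> L2 PX \<longleftrightarrow> (\<lambda>x. g \<bullet> \<mu>YX x) \<in> L2 PX"
        by (rule L2_cong) (simp only: space_PX f_eq)
      then have "f g \<in> L2C_class PX (f g)"
        using P_inner by (simp add: L2C_class_def eq_mod_const_def)
      then have "f g \<in> L2C_class PX (evH h)" by (simp only: h)
      then obtain c where "AE x in PX. evH h x - f g x = c"
        by (auto simp: L2C_class_def eq_mod_const_def)
      then show ?thesis by (rule affine)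
    qed
  qed
  show ?thesis unfolding predictor using 1 2 3 4 by blast
qed

end
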